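(* The semi-discrete scheme $$\frac{d \mathbf U_{i,j}}{d t}= -\frac{\tilde{\boldsymbol f}_{x, i+\frac12, j}-\tilde{\boldsymbol f}_{x, i-\frac12, j}}{\Delta x}-\frac{\tilde{\boldsymbol f}_{y, i, j+\frac12}-\tilde{\boldsymbol f}_{y, i, j-\frac12}}{\Delta y} -\mathbf C_x(\mathbf U_{i,j})\left(\frac{\partial \mathbf U}{\partial x} \right)_{i,j} -\mathbf C_y(\mathbf U_{i,j}) \left(\frac{\partial \mathbf U}{\partial y} \right)_{i,j}$$ (with $\mathbf U_{i,j}(t)\in\Omega$), with fluxes $\tilde{\boldsymbol f}_{x,i+\frac12,j}=\tilde{\boldsymbol f}_x(\mathbf U_{i,j},\mathbf U_{i+1,j})$ and $\tilde{\boldsymbol f}_{y,i,j+\frac12}=\tilde{\boldsymbol f}_y(\mathbf U_{i,j},\mathbf U_{i,j+1})$ and with second-order central difference approximations of $(\partial\mathbf U/\partial x)_{i,j}$ and $(\partial\mathbf U/\partial y)_{i,j}$, is a second-order accurate approximation of $$\frac{\partial \mathbf U}{\partial t}+\frac{\partial \mathbf f_{x}}{\partial x} + \frac{\partial \mathbf f_{y}}{\partial y} + \mathbf C_{x}(\mathbf U)\frac{\partial \mathbf U}{\partial x} + \mathbf C_{y}(\mathbf U)\frac{\partial \mathbf U}{\partial y}=0$$ and is entropy conservative, i.e. $$\frac{d}{d t} \mathcal E(\mathbf U_{i, j})+\frac{\tilde{\mathbf q}_{x, i+\frac12, j}-\tilde{\mathbf q}_{x, i-\frac12, j}}{\Delta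 x}+\frac{\tilde{\mathbf q}_{y, i, j+\frac12}-\tilde{\mathbf q}_{y, i, j-\frac12}}{\Delta y}=0$$ holds, where the numerical entropy fluxes $$\tilde{\mathbf q}_{x, i+\frac12, j}=\bar{\boldsymbol{\mathcal V}}_{i+\frac12, j} \cdot \tilde{\boldsymbol f}_{x,i+\frac12, j} - \bar{\mathcal F}_{x, i+\frac12, j},\qquad \tilde{\mathbf q}_{y, i, j+\frac12}=\bar{\boldsymbol{\mathcal V}}_{i, j+\frac12} \cdot \tilde{\boldsymbol f}_{ y,i, j+\frac12} - \bar{\mathcal F}_{y, i, j+\frac12}$$ are consistent with the entropy fluxes $\mathbf q_x=-\rho v_xs$ and $\mathbf q_y=-\rho v_ys$.
   Context: **Continuous system** (reformulated One-Fluid Two-Temperature Euler system). Constants $\gamma_e>1$, $\gamma_i>1$. $\mathbf U=(\rho,\rho v_x,\rho v_y,E,p_i)^\top$, $\boldsymbol v=(v_x,v_y)$, with $p_e$ determined by $E=\frac{p_e}{\gamma_e-1}+\frac{p_i}{\gamma_i-1}+\frac{\rho|\boldsymbol v|^2}{2}$. Admissible set $\Omega=\{\mathbf U\in\mathbb R^5:\rho>0,\ p_e>0,\ p_i>0\}$. Fluxes: $\mathbf f_x=(\rho v_x,\ \rho v_x^2+2p_e,\ \rho v_xv_y,\ (E+2p_e)v_x,\ p_iv_x)^\top$, $\mathbf f_y=(\rho v_y,\ \rho v_xv_y,\ \rho v_y^2+2p_e,\ (E+2p_e)v_y,\ p_iv_y)^\top$. Matrices: $$\mathbf C_x=\begin{pmatrix}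 0&0&0&0&0\\ -\frac{(\gamma_e-1)|\boldsymbol v|^2}{2}&(\gamma_e-1)v_x&(\gamma_e-1)v_y&-(\gamma_e-1)&\frac{\gamma_e-1}{\gamma_i-1}+1\\ 0&0&0&0&0\\ -\left(\frac{(\gamma_e-1)|\boldsymbol v|^2}{2}+\frac{p_i-p_e}{\rho}\right)v_x&(\gamma_e-1)v_x^2+\frac{p_i-p_e}{\rho}&(\gamma_e-1)v_xv_y&-(\gamma_e-1)v_x&\left(\frac{\gamma_e-1}{\gamma_i-1}+1\right)v_x\\ -\frac{(\gamma_i-1)p_iv_x}{\rho}&\frac{(\gamma_i-1)p_i}{\rho}&0&0&0\end{pmatrix},$$ $$\mathbf C_y=\begin{pmatrix} 0&0&0&0&0\\ 0&0&0&0&0\\ -\frac{(\gamma_e-1)|\boldsymbol v|^2}{2}&(\gamma_e-1)v_x&(\gamma_e-1)v_y&-(\gamma_e-1)&\frac{\gamma_e-1}{\gamma_i-1}+1\\ -\left(\frac{(\gamma_e-1)|\boldsymbol v|^2}{2}+\frac{p_i-p_e}{\rho}\right)v_y&(\gamma_e-1)v_xv_y&(\gamma_e-1)v_y^2+\frac{p_i-p_e}{\rho}&-(\gamma_e-1)v_y&\left(\frac{\gamma_e-1}{\gamma_i-1}+1\right)v_y\\ -\frac{(\gamma_i-1)p_iv_y}{\rho}&0&\frac{(\gamma_i-1)p_i}{\rho}&0&0\end{pmatrix}.$$ **Entropy.** $s=\frac{1}{\gamma_e-1}\ln\frac{p_e}{\rho^{\gamma_e}}+\frac1{\gamma_i-1}\ln\frac{p_i}{\rho^{\gamma_i}}$,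 $\mathcal E=-\rho s$. With $\beta_e=\rho/p_e$, $\beta_i=\rho/p_i$, the entropy variable is $$\boldsymbol{\mathcal V}=\frac{\partial\mathcal E}{\partial\mathbf U}=\Big(\tfrac{\gamma_e}{\gamma_e-1}+\tfrac{\gamma_i}{\gamma_i-1}-s-\tfrac{\beta_e|\boldsymbol v|^2}{2},\ \beta_ev_x,\ \beta_ev_y,\ -\beta_e,\ \tfrac{\beta_e-\beta_i}{\gamma_i-1}\Big)^\top.$$ Entropy potentials: $\mathcal F_d=\boldsymbol{\mathcal V}\cdot\mathbf f_d-\mathbf q_d=2\rho v_d$, $d\in\{x,y\}$. **Grid notation.** Uniform mesh of size $(\Delta x,\Delta y)$ with grid points $(x_i,y_j)$; statements at $(i,j)$ concern grid indices for which all stencil values are available. A bar with subscript $i+\frac12,j$ (resp. $i,j+\frac12$) is the arithmetic mean of the values at $(i,j)$ and $(i+1,j)$ (resp. $(i,j+1)$). The second-order central differences are $\frac{\mathbf U_{i+1,j}-\mathbf U_{i-1,j}}{2\Delta x}$ and $\frac{\mathbf U_{i,j+1}-\mathbf U_{i,j-1}}{2\Delta y}$. **Two-point fluxes.** For $\mathbf U_l,\mathbf U_r\in\Omega$ put $\bar a=\frac{a_l+a_r}2$, $a^{\ln}=\frac{a_r-a_l}{\ln a_r-\ln a_l}$ (with $a^{\ln}=a_l$ if $a_l=a_r$); $\overline{|v|^2}$ is the mean of $|\boldsymbol v|^2$. The components of $\tilde{\boldsymbol f}_x(\mathbf U_l,\mathbf U_r)$ are $$\tilde f_x^{(1)}=\rho^{\ln}\bar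 v_x,\quad \tilde f_x^{(2)}=\tfrac{2\bar\rho}{\bar\beta_e}+\bar v_x\tilde f_x^{(1)},\quad \tilde f_x^{(3)}=\bar v_y\tilde f_x^{(1)},\quad \tilde f_x^{(5)}=\tfrac{\tilde f_x^{(1)}}{\beta_i^{\ln}},$$ $$\tilde f_x^{(4)}=\Big[\tfrac1{(\gamma_e-1)\beta_e^{\ln}}-\tfrac{\overline{|v|^2}}2\Big]\tilde f_x^{(1)}+\bar v_x\tilde f_x^{(2)}+\bar v_y\tilde f_x^{(3)}+\tfrac{\tilde f_x^{(5)}}{\gamma_i-1},$$ and those of $\tilde{\boldsymbol f}_y(\mathbf U_l,\mathbf U_r)$ are $$\tilde f_y^{(1)}=\rho^{\ln}\bar v_y,\quad \tilde f_y^{(2)}=\bar v_x\tilde f_y^{(1)},\quad \tilde f_y^{(3)}=\tfrac{2\bar\rho}{\bar\beta_e}+\bar v_y\tilde f_y^{(1)},\quad \tilde f_y^{(5)}=\tfrac{\tilde f_y^{(1)}}{\beta_i^{\ln}},$$ $$\tilde f_y^{(4)}=\Big[\tfrac1{(\gamma_e-1)\beta_e^{\ln}}-\tfrac{\overline{|v|^2}}2\Big]\tilde f_y^{(1)}+\bar v_x\tilde f_y^{(2)}+\bar v_y\tilde f_y^{(3)}+\tfrac{\tilde f_y^{(5)}}{\gamma_i-1}.$$ A numerical (entropy) flux is consistent with a continuous one if it reduces to it when its state arguments coincide. *)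

theory Defs
  imports "HOL-Analysis.Analysis"
begin

section \<open>Vectors with five components\<close>

lemma exhaust_5:
  fixes x :: 5
  shows "x = 1 \<or> x = 2 \<or> x = 3 \<or> x = 4 \<or> x = 5"
proof (induct x)
  case (of_int z)
  then have "0 \<le> z" and "z < 5" by simp_all
  then have "z = 0 \<or> z = 1 \<or> z = 2 \<or> z = 3 \<or> z = 4" by arith
  then show ?case by auto
qed

lemma forall_5: "(\<forall>i::5. P i) \<longleftrightarrow> P 1 \<and> P 2 \<and> P 3 \<and> P 4 \<and> P 5"
  by (metis exhaust_5)

lemma UNIV_5: "UNIV = {1, 2, 3, 4, 5::5}"
  using exhaust_5 by auto

lemma sum_5: "sum f (UNIV::5 set) = f 1 + f 2 + f 3 + f 4 + f 5"
  unfolding UNIV_5 by (simp add: ac_simps)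

lemma vector_5 [simp]:
  "(vector [a, b, c, d, e] :: ('a::zero)^5) $ 1 = a"
  "(vector [a, b, c, d, e] :: ('a::zero)^5) $ 2 = b"
  "(vector [a, b, c, d, e] :: ('a::zero)^5) $ 3 = c"
  "(vector [a, b, c, d, e] :: ('a::zero)^5) $ 4 = d"
  "(vector [a, b, c, d, e] :: ('a::zero)^5) $ 5 = e"
  unfolding vector_def by simp_all


section \<open>The reformulated one-fluid two-temperature Euler system\<close>

text \<open>
  The parameters \<open>ge\<close> and \<open>gi\<close> are the adiabatic constants of electrons and ions.  A state is
  \<open>(\<rho>, \<rho> v\<^sub>x, \<rho> v\<^sub>y, E, p\<^sub>i)\<close>.
\<close>

type_synonym state = "real ^ 5"

definition rho :: "state \<Rightarrow> real" where "rho U = U $ 1"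
definition vel_x :: "state \<Rightarrow> real" where "vel_x U = U $ 2 / U $ 1"
definition vel_y :: "state \<Rightarrow> real" where "vel_y U = U $ 3 / U $ 1"
definition vel_sq :: "state \<Rightarrow> real" where "vel_sq U = (vel_x U)\<^sup>2 + (vel_y U)\<^sup>2"
definition energy :: "state \<Rightarrow> real" where "energy U = U $ 4"
definition p_i :: "state \<Rightarrow> real" where "p_i U = U $ 5"

definition p_e :: "real \<Rightarrow> real \<Rightarrow> state \<Rightarrow> real" where
  "p_e ge gi U = (ge - 1) * (energy U - p_i U / (gi - 1) - rho U * vel_sq U / 2)"

lemma energy_eq:
  assumes "ge > 1"
  shows "energy U = p_e ge gi U / (ge - 1) + p_i U / (gi - 1) + rho U * vel_sq U / 2"
  using assms by (simp add: p_e_def)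

definition admissible :: "real \<Rightarrow> real \<Rightarrow> state set" where
  "admissible ge gi = {U. rho U > 0 \<and> p_e ge gi U > 0 \<and> p_i U > 0}"

definition flux_x :: "real \<Rightarrow> real \<Rightarrow> state \<Rightarrow> state" where
  "flux_x ge gi U =
     vector [rho U * vel_x U,
             rho U * (vel_x U)\<^sup>2 + 2 * p_e ge gi U,
             rho U * vel_x U * vel_y U,
             (energy U + 2 * p_e ge gi U) * vel_x U,
             p_i U * vel_x U]"

definition flux_y :: "real \<Rightarrow> real \<Rightarrow> state \<Rightarrow> state" where
  "flux_y ge gi U =
     vector [rho U * vel_y U,
             rho U * vel_x U * vel_y U,
             rho U * (vel_y U)\<^sup>2 + 2 * p_e ge gi U,
             (energy U + 2 * p_e ge gi U) * vel_y U,
             p_i U * vel_y U]"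

definition C_x :: "real \<Rightarrow> real \<Rightarrow> state \<Rightarrow> real ^ 5 ^ 5" where
  "C_x ge gi U =
    (let r = rho U; vx = vel_x U; vy = vel_y U; v2 = vel_sq U; pe = p_e ge gi U; pion = p_i U in
     vector
      [vector [0, 0, 0, 0, 0],
       vector [- ((ge - 1) * v2 / 2), (ge - 1) * vx, (ge - 1) * vy, - (ge - 1),
               (ge - 1) / (gi - 1) + 1],
       vector [0, 0, 0, 0, 0],
       vector [- (((ge - 1) * v2 / 2 + (pion - pe) / r) * vx),
               (ge - 1) * vx\<^sup>2 + (pion - pe) / r,
               (ge - 1) * vx * vy,
               - ((ge - 1) * vx),
               ((ge - 1) / (gi - 1) + 1) * vx],
       vector [- ((gi - 1) * pion * vx / r), (gi - 1) * pion / r, 0, 0, 0]])"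

definition C_y :: "real \<Rightarrow> real \<Rightarrow> state \<Rightarrow> real ^ 5 ^ 5" where
  "C_y ge gi U =
    (let r = rho U; vx = vel_x U; vy = vel_y U; v2 = vel_sq U; pe = p_e ge gi U; pion = p_i U in
     vector
      [vector [0, 0, 0, 0, 0],
       vector [0, 0, 0, 0, 0],
       vector [- ((ge - 1) * v2 / 2), (ge - 1) * vx, (ge - 1) * vy, - (ge - 1),
               (ge - 1) / (gi - 1) + 1],
       vector [- (((ge - 1) * v2 / 2 + (pion - pe) / r) * vy),
               (ge - 1) * vx * vy,
               (ge - 1) * vy\<^sup>2 + (pion - pe) / r,
               - ((ge - 1) * vy),
               ((ge - 1) / (gi - 1) + 1) * vy],
       vector [- ((gi - 1) * pion * vy / r), 0, (gi - 1) * pion / r, 0, 0]])"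


section \<open>Entropy\<close>

definition beta_e :: "real \<Rightarrow> real \<Rightarrow> state \<Rightarrow> real" where
  "beta_e ge gi U = rho U / p_e ge gi U"

definition beta_i :: "state \<Rightarrow> real" where
  "beta_i U = rho U / p_i U"

definition spec_entropy :: "real \<Rightarrow> real \<Rightarrow> state \<Rightarrow> real" where
  "spec_entropy ge gi U =
     1 / (ge - 1) * ln (p_e ge gi U / rho U powr ge) + 1 / (gi - 1) * ln (p_i U / rho U powr gi)"

definition entropy :: "real \<Rightarrow> real \<Rightarrow> state \<Rightarrow> real" where
  "entropy ge gi U = - (rho U * spec_entropy ge gi U)"

definition entropy_flux_x :: "real \<Rightarrow> real \<Rightarrow> state \<Rightarrow> real" where
  "entropy_flux_x ge gi U = - (rho U * vel_x U * spec_entropy ge gi U)"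

definition entropy_flux_y :: "real \<Rightarrow> real \<Rightarrow> state \<Rightarrow> real" where
  "entropy_flux_y ge gi U = - (rho U * vel_y U * spec_entropy ge gi U)"

definition entropy_var :: "real \<Rightarrow> real \<Rightarrow> state \<Rightarrow> state" where
  "entropy_var ge gi U =
     vector [ge / (ge - 1) + gi / (gi - 1) - spec_entropy ge gi U - beta_e ge gi U * vel_sq U / 2,
             beta_e ge gi U * vel_x U,
             beta_e ge gi U * vel_y U,
             - beta_e ge gi U,
             (beta_e ge gi U - beta_i U) / (gi - 1)]"

definition potential_x :: "real \<Rightarrow> real \<Rightarrow> state \<Rightarrow> real" where
  "potential_x ge gi U = entropy_var ge gi U \<bullet> flux_x ge gi U - entropy_flux_x ge gi U"

definition potential_y :: "real \<Rightarrow> real \<Rightarrow> state \<Rightarrow> real" where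
  "potential_y ge gi U = entropy_var ge gi U \<bullet> flux_y ge gi U - entropy_flux_y ge gi U"

text \<open>\<^const>\<open>entropy_var\<close> is the gradient of the entropy.\<close>

lemma GDERIV_entropy:
  assumes g: "ge > 1" "gi > 1" and U: "U \<in> admissible ge gi"
  shows "GDERIV (entropy ge gi) U :> entropy_var ge gi U"
proof -
  define pe :: "state \<Rightarrow> real" where
    "pe W = (ge - 1) * (W $ 4 - W $ 5 / (gi - 1) - ((W $ 2)\<^sup>2 + (W $ 3)\<^sup>2) / W $ 1 / 2)" for W
  have pe_eq: "p_e ge gi W = pe W" if "W $ 1 > 0" for W
    using that by (simp add: p_e_def pe_def energy_def p_i_def rho_def vel_sq_def vel_x_def
        vel_y_def field_simps power2_eq_square)
  have r: "U $ 1 > 0" and pion: "U $ 5 > 0" and pe: "pe U > 0"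
    using U pe_eq by (auto simp: admissible_def rho_def p_i_def)
  define S :: "state \<Rightarrow> real" where
    "S W = (ln (pe W) - ge * ln (W $ 1)) / (ge - 1) + (ln (W $ 5) - gi * ln (W $ 1)) / (gi - 1)" for W
  have S_eq: "spec_entropy ge gi W = S W" if "W $ 1 > 0" "W $ 5 > 0" "pe W > 0" for W
    using that pe_eq[OF that(1)]
    by (simp add: spec_entropy_def S_def rho_def p_i_def ln_div ln_powr)
  have nth: "((\<lambda>W::state. W $ k) has_derivative (\<lambda>h. h $ k)) (at U)" for k
    by (rule bounded_linear.has_derivative[OF bounded_linear_vec_nth has_derivative_ident])
  define dpe where "dpe h = (ge - 1) * (h $ 4 - h $ 5 / (gi - 1)
     - (2 * U $ 2 * h $ 2 + 2 * U $ 3 * h $ 3) / U $ 1 / 2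
     + ((U $ 2)\<^sup>2 + (U $ 3)\<^sup>2) * h $ 1 / (U $ 1)\<^sup>2 / 2)" for h :: state
  have dkin: "((\<lambda>W. ((W $ 2)\<^sup>2 + (W $ 3)\<^sup>2) / W $ 1) has_derivative
      (\<lambda>h. ((2 * U $ 2 * h $ 2 + 2 * U $ 3 * h $ 3) * U $ 1
        - ((U $ 2)\<^sup>2 + (U $ 3)\<^sup>2) * h $ 1) / (U $ 1 * U $ 1))) (at U)"
    using r by (intro has_derivative_divide' nth) (auto intro!: derivative_eq_intros nth)
  have "((\<lambda>W. (ge - 1) * (W $ 4 - inverse (gi - 1) * W $ 5
        - inverse 2 * (((W $ 2)\<^sup>2 + (W $ 3)\<^sup>2) / W $ 1))) has_derivative
      (\<lambda>h. (ge - 1) * (h $ 4 - inverse (gi - 1) * h $ 5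
        - inverse 2 * (((2 * U $ 2 * h $ 2 + 2 * U $ 3 * h $ 3) * U $ 1
            - ((U $ 2)\<^sup>2 + (U $ 3)\<^sup>2) * h $ 1) / (U $ 1 * U $ 1))))) (at U)"
    by (intro has_derivative_mult_right has_derivative_diff nth dkin)
  moreover have "(\<lambda>W::state. (ge - 1) * (W $ 4 - inverse (gi - 1) * W $ 5
        - inverse 2 * (((W $ 2)\<^sup>2 + (W $ 3)\<^sup>2) / W $ 1))) = pe"
    by (simp add: fun_eq_iff pe_def inverse_eq_divide)
  moreover have "(\<lambda>h::state. (ge - 1) * (h $ 4 - inverse (gi - 1) * h $ 5
        - inverse 2 * (((2 * U $ 2 * h $ 2 + 2 * U $ 3 * h $ 3) * U $ 1
            - ((U $ 2)\<^sup>2 + (U $ 3)\<^sup>2) * h $ 1) / (U $ 1 * U $ 1)))) = dpe"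
    using r g by (simp add: fun_eq_iff dpe_def divide_simps)
      (simp add: algebra_simps power2_eq_square)
  ultimately have dpe: "(pe has_derivative dpe) (at U)" by simp
  have dS: "((\<lambda>W. - (W $ 1 * S W)) has_derivative (\<lambda>h. - (h $ 1 * S U + U $ 1 *
      ((dpe h / pe U - ge * h $ 1 / U $ 1) / (ge - 1)
       + (h $ 5 / U $ 5 - gi * h $ 1 / U $ 1) / (gi - 1))))) (at U)"
    unfolding S_def using r pion pe g
    by (auto intro!: derivative_eq_intros nth dpe simp: divide_inverse algebra_simps)
  have pos_nhds: "\<forall>\<^sub>F W in nhds U. f W > 0"
    if "(f has_derivative f') (at U)" "f U > 0" for f :: "state \<Rightarrow> real" and f'
    using that has_derivative_continuous[OF that(1)]
    by (auto simp: isCont_def tendsto_at_iff_tendsto_nhds dest: order_tendstoD(1))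
  have "\<forall>\<^sub>F W in nhds U. pe W > 0 \<and> W $ 1 > 0 \<and> W $ 5 > 0"
    using pos_nhds[OF dpe pe] pos_nhds[OF nth r] pos_nhds[OF nth pion]
    by (intro eventually_conj)
  then have ev: "\<forall>\<^sub>F W in nhds U. - (W $ 1 * S W) = entropy ge gi W"
    by eventually_elim (simp add: entropy_def rho_def S_eq)
  have deriv: "(\<lambda>h. - (h $ 1 * S U + U $ 1 *
      ((dpe h / pe U - ge * h $ 1 / U $ 1) / (ge - 1)
       + (h $ 5 / U $ 5 - gi * h $ 1 / U $ 1) / (gi - 1)))) = (\<lambda>h. h \<bullet> entropy_var ge gi U)"
  proof
    fix h :: state
    define P where "P = pe U"
    define a where "a = ge - 1"
    define b where "b = gi - 1"
    have pos: "P > 0" "a > 0" "b > 0" using pe g by (auto simp: P_def a_def b_def)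
    have gg: "ge = a + 1" "gi = b + 1" by (auto simp: a_def b_def)
    show "- (h $ 1 * S U + U $ 1 * ((dpe h / pe U - ge * h $ 1 / U $ 1) / (ge - 1)
       + (h $ 5 / U $ 5 - gi * h $ 1 / U $ 1) / (gi - 1))) = h \<bullet> entropy_var ge gi U"
      unfolding entropy_var_def inner_vec_def sum_5 S_eq[OF r pion pe] beta_e_def beta_i_def
        pe_eq[OF r] rho_def p_i_def vel_sq_def vel_x_def vel_y_def dpe_def P_def [symmetric]
      using pos r pion unfolding gg
      by (simp add: divide_simps) (simp add: algebra_simps power2_eq_square)
  qed
  have "(entropy ge gi has_derivative (\<lambda>h. h \<bullet> entropy_var ge gi U)) (at U)"
  proof (rule has_derivative_transform_eventually[OF dS[unfolded deriv]])
    show "\<forall>\<^sub>F W in at U. - (W $ 1 * S W) = entropy ge gi W"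
      using ev by (auto simp: eventually_at_filter elim: eventually_mono)
    show "- (U $ 1 * S U) = entropy ge gi U"
      using ev by (rule eventually_nhds_x_imp_x)
  qed simp
  then show ?thesis
    unfolding gderiv_def .
qed

lemma potential_x_eq:
  assumes g: "ge > 1" "gi > 1" and U: "U \<in> admissible ge gi"
  shows "potential_x ge gi U = 2 * rho U * vel_x U"
proof -
  have r: "rho U > 0" and pe: "p_e ge gi U > 0" and pion: "p_i U > 0"
    using U by (auto simp: admissible_def)
  show ?thesis
    unfolding potential_x_def entropy_var_def flux_x_def entropy_flux_x_def inner_vec_def sum_5
      energy_eq[OF g(1), of U gi] beta_e_def beta_i_def vel_sq_def
    using g r pe pion by (simp add: divide_simps) (simp add: algebra_simps power2_eq_square)
qed

lemma potential_y_eq: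
  assumes g: "ge > 1" "gi > 1" and U: "U \<in> admissible ge gi"
  shows "potential_y ge gi U = 2 * rho U * vel_y U"
proof -
  have r: "rho U > 0" and pe: "p_e ge gi U > 0" and pion: "p_i U > 0"
    using U by (auto simp: admissible_def)
  show ?thesis
    unfolding potential_y_def entropy_var_def flux_y_def entropy_flux_y_def inner_vec_def sum_5
      energy_eq[OF g(1), of U gi] beta_e_def beta_i_def vel_sq_def
    using g r pe pion by (simp add: divide_simps) (simp add: algebra_simps power2_eq_square)
qed

section \<open>Two-point numerical fluxes\<close>

definition avg :: "('s \<Rightarrow> 'a::real_vector) \<Rightarrow> 's \<Rightarrow> 's \<Rightarrow> 'a" where
  "avg a Ul Ur = (a Ul + a Ur) /\<^sub>R 2"

definition log_mean :: "('s \<Rightarrow> real) \<Rightarrow> 's \<Rightarrow> 's \<Rightarrow> real" where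
  "log_mean a Ul Ur =
     (if a Ul = a Ur then a Ul else (a Ur - a Ul) / (ln (a Ur) - ln (a Ul)))"

definition num_flux_x :: "real \<Rightarrow> real \<Rightarrow> state \<Rightarrow> state \<Rightarrow> state" where
  "num_flux_x ge gi Ul Ur =
    (let f1 = log_mean rho Ul Ur * avg vel_x Ul Ur;
         f2 = 2 * avg rho Ul Ur / avg (beta_e ge gi) Ul Ur + avg vel_x Ul Ur * f1;
         f3 = avg vel_y Ul Ur * f1;
         f5 = f1 / log_mean beta_i Ul Ur;
         f4 = (1 / ((ge - 1) * log_mean (beta_e ge gi) Ul Ur) - avg vel_sq Ul Ur / 2) * f1
              + avg vel_x Ul Ur * f2 + avg vel_y Ul Ur * f3 + f5 / (gi - 1)
     in vector [f1, f2, f3, f4, f5])"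

definition num_flux_y :: "real \<Rightarrow> real \<Rightarrow> state \<Rightarrow> state \<Rightarrow> state" where
  "num_flux_y ge gi Ul Ur =
    (let f1 = log_mean rho Ul Ur * avg vel_y Ul Ur;
         f2 = avg vel_x Ul Ur * f1;
         f3 = 2 * avg rho Ul Ur / avg (beta_e ge gi) Ul Ur + avg vel_y Ul Ur * f1;
         f5 = f1 / log_mean beta_i Ul Ur;
         f4 = (1 / ((ge - 1) * log_mean (beta_e ge gi) Ul Ur) - avg vel_sq Ul Ur / 2) * f1
              + avg vel_x Ul Ur * f2 + avg vel_y Ul Ur * f3 + f5 / (gi - 1)
     in vector [f1, f2, f3, f4, f5])"

definition num_entropy_flux_x :: "real \<Rightarrow> real \<Rightarrow> state \<Rightarrow> state \<Rightarrow> real" where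
  "num_entropy_flux_x ge gi Ul Ur =
     avg (entropy_var ge gi) Ul Ur \<bullet> num_flux_x ge gi Ul Ur - avg (potential_x ge gi) Ul Ur"

definition num_entropy_flux_y :: "real \<Rightarrow> real \<Rightarrow> state \<Rightarrow> state \<Rightarrow> real" where
  "num_entropy_flux_y ge gi Ul Ur =
     avg (entropy_var ge gi) Ul Ur \<bullet> num_flux_y ge gi Ul Ur - avg (potential_y ge gi) Ul Ur"

definition consistent_on :: "'s set \<Rightarrow> ('s \<Rightarrow> 's \<Rightarrow> 'a) \<Rightarrow> ('s \<Rightarrow> 'a) \<Rightarrow> bool" where
  "consistent_on S fnum f \<longleftrightarrow> (\<forall>U\<in>S. fnum U U = f U)"


section \<open>The semi-discrete scheme\<close>

type_synonym grid_fun = "int \<Rightarrow> int \<Rightarrow> state"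

definition central_x :: "real \<Rightarrow> grid_fun \<Rightarrow> grid_fun" where
  "central_x dx u i j = (u (i + 1) j - u (i - 1) j) /\<^sub>R (2 * dx)"

definition central_y :: "real \<Rightarrow> grid_fun \<Rightarrow> grid_fun" where
  "central_y dy u i j = (u i (j + 1) - u i (j - 1)) /\<^sub>R (2 * dy)"

definition scheme_rhs :: "real \<Rightarrow> real \<Rightarrow> real \<Rightarrow> real \<Rightarrow> grid_fun \<Rightarrow> grid_fun" where
  "scheme_rhs ge gi dx dy u i j =
     - ((num_flux_x ge gi (u i j) (u (i + 1) j) - num_flux_x ge gi (u (i - 1) j) (u i j)) /\<^sub>R dx)
     - (num_flux_y ge gi (u i j) (u i (j + 1)) - num_flux_y ge gi (u i (j - 1)) (u i j)) /\<^sub>R dy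
     - C_x ge gi (u i j) *v central_x dx u i j
     - C_y ge gi (u i j) *v central_y dy u i j"

definition stencil :: "int \<Rightarrow> int \<Rightarrow> (int \<times> int) set" where
  "stencil i j = {(i, j), (i + 1, j), (i - 1, j), (i, j + 1), (i, j - 1)}"

text \<open>
  \<open>u i j t\<close> is the value at the grid point with index \<open>(i, j)\<close> at time \<open>t\<close>.  The set \<open>G\<close> contains
  the indices at which grid values are available and \<open>T\<close> the times; no equation is imposed
  at indices whose stencil is not contained in \<open>G\<close>.
\<close>

definition scheme_solution ::
    "real \<Rightarrow> real \<Rightarrow> real \<Rightarrow> real \<Rightarrow> (int \<times> int) set \<Rightarrow> real set \<Rightarrow>
     (int \<Rightarrow> int \<Rightarrow> real \<Rightarrow> state) \<Rightarrow> bool" where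
  "scheme_solution ge gi dx dy G T u \<longleftrightarrow>
     (\<forall>(i, j)\<in>G. \<forall>t\<in>T. u i j t \<in> admissible ge gi) \<and>
     (\<forall>i j. stencil i j \<subseteq> G \<longrightarrow>
        (\<forall>t\<in>T. (u i j has_vector_derivative scheme_rhs ge gi dx dy (\<lambda>k l. u k l t) i j)
                 (at t within T)))"


section \<open>Second-order accuracy\<close>

text \<open>\<open>C\<^sup>n\<close> functions; meant for open sets \<open>S\<close>.\<close>

fun C_on :: "nat \<Rightarrow> ('a::real_normed_vector \<Rightarrow> 'b::real_normed_vector) \<Rightarrow> 'a set \<Rightarrow> bool" where
  "C_on 0 f S \<longleftrightarrow> continuous_on S f"
| "C_on (Suc n) f S \<longleftrightarrow>
     (\<forall>x\<in>S. f differentiable (at x)) \<and>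
     (\<forall>v. C_on n (\<lambda>x. frechet_derivative f (at x) v) S)"

type_synonym field = "real \<times> real \<times> real \<Rightarrow> state"

text \<open>Fields are functions of \<open>(t, x, y)\<close>.\<close>

definition pde_residual :: "real \<Rightarrow> real \<Rightarrow> field \<Rightarrow> field" where
  "pde_residual ge gi U = (\<lambda>(t, x, y).
     vector_derivative (\<lambda>s. U (s, x, y)) (at t)
     + vector_derivative (\<lambda>s. flux_x ge gi (U (t, s, y))) (at x)
     + vector_derivative (\<lambda>s. flux_y ge gi (U (t, x, s))) (at y)
     + C_x ge gi (U (t, x, y)) *v vector_derivative (\<lambda>s. U (t, s, y)) (at x)
     + C_y ge gi (U (t, x, y)) *v vector_derivative (\<lambda>s. U (t, x, s)) (at y))"

definition scheme_residual ::
    "real \<Rightarrow> real \<Rightarrow> real \<Rightarrow> real \<Rightarrow> (int \<Rightarrow> int \<Rightarrow> real \<Rightarrow> state) \<Rightarrow> int \<Rightarrow> int \<Rightarrow> real \<Rightarrow> state"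
  where
  "scheme_residual ge gi dx dy u i j t =
     vector_derivative (u i j) (at t) - scheme_rhs ge gi dx dy (\<lambda>k l. u k l t) i j"

definition sample :: "real \<Rightarrow> real \<Rightarrow> real \<Rightarrow> real \<Rightarrow> field \<Rightarrow> int \<Rightarrow> int \<Rightarrow> real \<Rightarrow> state" where
  "sample x0 y0 dx dy U i j t = U (t, x0 + of_int i * dx, y0 + of_int j * dy)"

text \<open>
  The local truncation error, i.e. the difference between the scheme and the differential
  equation on the grid values of an admissible \<open>C\<^sup>3\<close> field, is \<open>O(dx\<^sup>2 + dy\<^sup>2)\<close>,
  uniformly on compact sets and in the position \<open>(x0, y0)\<close> of the grid.  If the field solves the
  differential equation, this bounds the residual of its grid values in the scheme.
\<close>

definition second_order_accurate :: "real \<Rightarrow> real \<Rightarrow> bool" where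
  "second_order_accurate ge gi \<longleftrightarrow>
     (\<forall>D U K. open D \<and> C_on 3 U D \<and> U ` D \<subseteq> admissible ge gi \<and> compact K \<and> K \<subseteq> D \<longrightarrow>
       (\<exists>B. \<exists>\<delta>>0. \<forall>dx dy x0 y0 t i j.
          0 < dx \<and> dx < \<delta> \<and> 0 < dy \<and> dy < \<delta> \<and>
          (t, x0 + of_int i * dx, y0 + of_int j * dy) \<in> K \<longrightarrow>
          norm (scheme_residual ge gi dx dy (sample x0 y0 dx dy U) i j t
                - pde_residual ge gi U (t, x0 + of_int i * dx, y0 + of_int j * dy))
            \<le> B * (dx\<^sup>2 + dy\<^sup>2)))"

end

theory Submission
  imports Defs "HOL-Real_Asymp.Real_Asymp"
begin

text \<open>
  Entropy conservation is Tadmor's argument.  The two-point flux satisfies the jump identity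
  \<open>(V\<^sub>r - V\<^sub>l) \<bullet> f = F\<^sub>r - F\<^sub>l\<close> with the entropy variable \<open>V\<close> and the potential \<open>F\<close>
  (\<open>num_flux_x_jump\<close>), so that both \<open>V\<^sub>l \<bullet> f\<close> and \<open>V\<^sub>r \<bullet> f\<close> equal the numerical entropy flux up to
  the potential on the respective side.  In the difference of the two fluxes at a grid point the
  potential cancels.  The nonconservative terms do not contribute, because \<open>V\<close> is a left null
  vector of the matrices \<open>C_x\<close> and \<open>C_y\<close> (\<open>entropy_var_C_x\<close>).  As \<open>V\<close> is the gradient
  of the entropy, the chain rule turns this into the discrete entropy equation.

  For the accuracy, let \<open>u h\<close> be the field on a coordinate line through a grid point \<open>u 0\<close>.  The flux is
  symmetric in its two states, so the flux difference is \<open>g h - g (- h)\<close> with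
  \<open>g h = f (u 0) (u h)\<close>: a central difference again.  If \<open>g\<close> has an expansion
  \<open>a + b h + c h\<^sup>2 + O(h\<^sup>3)\<close>, then \<open>(g h - g (- h)) / h = 2 b + O(h\<^sup>2)\<close>.  It remains to see that \<open>2 b\<close>
  is the derivative of the exact flux along the line.  This holds since arithmetic and logarithmic
  means of \<open>q (u 0)\<close> and \<open>q (u h)\<close> have half the slope of \<open>q (u h)\<close>, and
  having the same value and half the slope is preserved by arithmetic operations
  (\<open>half_slope\<close>); the flux is composed from means by the same operations that compose the exact
  flux from the quantities themselves.  Working with expansions instead of derivatives of the two-point
  flux means that the only fact about the logarithmic mean near the diagonal is the
  expansion of \<open>w / ln (1 + w)\<close> at \<open>0\<close> (\<open>taylor2_log_mean\<close>).

  All remainder terms are uniform for base points in a compact set; this is encoded in a filter, so that the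
  calculus of Landau symbols applies.  The \<open>y\<close> direction follows from the \<open>x\<close> direction by exchanging the
  two momentum components.
\<close>

section \<open>Exchange of the coordinate directions\<close>

definition swap_xy :: "state \<Rightarrow> state" where
  "swap_xy U = vector [U $ 1, U $ 3, U $ 2, U $ 4, U $ 5]"

lemma swap_nth [simp]:
  "swap_xy U $ 1 = U $ 1" "swap_xy U $ 2 = U $ 3" "swap_xy U $ 3 = U $ 2"
  "swap_xy U $ 4 = U $ 4" "swap_xy U $ 5 = U $ 5"
  by (simp_all add: swap_xy_def)

lemma swap_swap [simp]: "swap_xy (swap_xy U) = U"
  by (simp add: vec_eq_iff forall_5)

lemma inner_swap: "swap_xy U \<bullet> swap_xy W = U \<bullet> W"
  by (simp add: inner_vec_def sum_5)

lemma linear_swap: "linear swap_xy"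
  by (rule linearI) (simp_all add: vec_eq_iff forall_5)

lemma norm_swap: "norm (swap_xy U) = norm U"
  by (simp add: norm_eq_sqrt_inner inner_swap)

lemma quantities_swap [simp]:
  "rho (swap_xy U) = rho U" "vel_x (swap_xy U) = vel_y U" "vel_y (swap_xy U) = vel_x U"
  "vel_sq (swap_xy U) = vel_sq U" "energy (swap_xy U) = energy U" "p_i (swap_xy U) = p_i U"
  "p_e ge gi (swap_xy U) = p_e ge gi U" "beta_e ge gi (swap_xy U) = beta_e ge gi U"
  "beta_i (swap_xy U) = beta_i U" "spec_entropy ge gi (swap_xy U) = spec_entropy ge gi U"
proof -
  have sq: "vel_sq (swap_xy U) = vel_sq U"
    by (simp add: vel_sq_def vel_x_def vel_y_def add.commute)
  then have pe: "p_e ge gi (swap_xy U) = p_e ge gi U"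
    by (simp add: p_e_def energy_def p_i_def rho_def)
  show "rho (swap_xy U) = rho U" "vel_x (swap_xy U) = vel_y U" "vel_y (swap_xy U) = vel_x U"
    "vel_sq (swap_xy U) = vel_sq U" "energy (swap_xy U) = energy U" "p_i (swap_xy U) = p_i U"
    "p_e ge gi (swap_xy U) = p_e ge gi U" "beta_e ge gi (swap_xy U) = beta_e ge gi U"
    "beta_i (swap_xy U) = beta_i U" "spec_entropy ge gi (swap_xy U) = spec_entropy ge gi U"
    using sq pe by (simp_all add: rho_def vel_x_def vel_y_def energy_def p_i_def
      beta_e_def beta_i_def spec_entropy_def)
qed

lemma admissible_swap [simp]: "swap_xy U \<in> admissible ge gi \<longleftrightarrow> U \<in> admissible ge gi"
  by (simp add: admissible_def)

lemma entropy_var_swap: "entropy_var ge gi (swap_xy U) = swap_xy (entropy_var ge gi U)"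
  by (simp add: vec_eq_iff forall_5 entropy_var_def)

lemma flux_y_swap: "flux_y ge gi U = swap_xy (flux_x ge gi (swap_xy U))"
  by (simp add: vec_eq_iff forall_5 flux_x_def flux_y_def mult_ac)

lemma C_y_swap: "C_y ge gi U *v w = swap_xy (C_x ge gi (swap_xy U) *v swap_xy w)"
  by (simp add: vec_eq_iff forall_5 C_x_def C_y_def matrix_vector_mult_def sum_5 Let_def mult_ac)

lemma num_flux_y_swap:
  "num_flux_y ge gi Ul Ur = swap_xy (num_flux_x ge gi (swap_xy Ul) (swap_xy Ur))"
  by (simp add: vec_eq_iff forall_5 num_flux_x_def num_flux_y_def Let_def avg_def log_mean_def)

text \<open>
  The exchange is an orthogonal involution, hence self-adjoint.
\<close>

lemma inner_swap_left: "swap_xy U \<bullet> W = U \<bullet> swap_xy W"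
  by (metis inner_swap swap_swap)

lemma potential_y_swap: "potential_y ge gi U = potential_x ge gi (swap_xy U)"
  by (simp add: potential_x_def potential_y_def flux_y_swap entropy_flux_x_def entropy_flux_y_def
      entropy_var_swap inner_swap_left)

lemma num_entropy_flux_y_swap:
  "num_entropy_flux_y ge gi Ul Ur = num_entropy_flux_x ge gi (swap_xy Ul) (swap_xy Ur)"
proof -
  have "avg (entropy_var ge gi) (swap_xy Ul) (swap_xy Ur) = swap_xy (avg (entropy_var ge gi) Ul Ur)"
    by (simp add: avg_def entropy_var_swap linear_add[OF linear_swap] linear_scale[OF linear_swap])
  moreover have "avg (potential_y ge gi) Ul Ur = avg (potential_x ge gi) (swap_xy Ul) (swap_xy Ur)"
    by (simp add: avg_def potential_y_swap)
  ultimately show ?thesis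
    by (simp only: num_entropy_flux_y_def num_entropy_flux_x_def num_flux_y_swap inner_swap_left)
qed

section \<open>Entropy conservation\<close>

lemma num_flux_x_sym: "num_flux_x ge gi Ul Ur = num_flux_x ge gi Ur Ul"
proof -
  have "log_mean q Ul Ur = log_mean q Ur Ul" for q :: "state \<Rightarrow> real"
    using minus_divide_divide[of "q Ur - q Ul" "ln (q Ur) - ln (q Ul)"]
    unfolding log_mean_def by simp
  moreover have "avg q Ul Ur = avg q Ur Ul" for q :: "state \<Rightarrow> real"
    by (simp add: avg_def add.commute)
  ultimately show ?thesis
    unfolding num_flux_x_def by metis
qed

lemma num_flux_x_consistent:
  assumes g: "ge > 1" "gi > 1" and U: "U \<in> admissible ge gi"
  shows "num_flux_x ge gi U U = flux_x ge gi U"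
proof -
  have r: "rho U > 0" and pe: "p_e ge gi U > 0" and pion: "p_i U > 0"
    using U by (auto simp: admissible_def)
  have "avg q U U = q U" for q :: "state \<Rightarrow> real"
    by (simp add: avg_def)
  then show ?thesis
    unfolding num_flux_x_def flux_x_def Let_def vec_eq_iff forall_5 vector_5
      energy_eq[OF g(1), of U gi] log_mean_def beta_e_def beta_i_def vel_sq_def
    using g r pe pion by (simp add: divide_simps) (simp add: algebra_simps power2_eq_square)
qed

lemma num_entropy_flux_x_consistent:
  assumes "ge > 1" "gi > 1" and "U \<in> admissible ge gi"
  shows "num_entropy_flux_x ge gi U U = entropy_flux_x ge gi U"
proof -
  have "avg q U U = q U" for q :: "state \<Rightarrow> real"
    by (simp add: avg_def)
  moreover have "avg (entropy_var ge gi) U U = entropy_var ge gi U"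
    by (simp add: avg_def vec_eq_iff)
  ultimately show ?thesis
    using assms by (simp add: num_entropy_flux_x_def num_flux_x_consistent potential_x_def)
qed

lemma num_entropy_flux_y_consistent:
  assumes "ge > 1" "gi > 1" and "U \<in> admissible ge gi"
  shows "num_entropy_flux_y ge gi U U = entropy_flux_y ge gi U"
  using assms by (simp add: num_entropy_flux_y_swap num_entropy_flux_x_consistent
      entropy_flux_x_def entropy_flux_y_def)

text \<open>
  This orthogonality is what allows the nonconservative terms to be discretised by arbitrary
  difference quotients \<open>w\<close> without disturbing the entropy balance.
\<close>

lemma entropy_var_C_x:
  assumes g: "ge > 1" "gi > 1" and U: "U \<in> admissible ge gi"
  shows "entropy_var ge gi U \<bullet> (C_x ge gi U *v w) = 0"
proof -
  have r: "rho U > 0" and pe: "p_e ge gi U > 0" and pion: "p_i U > 0"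
    using U by (auto simp: admissible_def)
  show ?thesis
    unfolding entropy_var_def C_x_def Let_def inner_vec_def sum_5 matrix_vector_mult_def
      beta_e_def beta_i_def
    using g r pe pion by (simp add: divide_simps) (simp add: algebra_simps power2_eq_square)
qed

lemma spec_entropy_beta:
  assumes g: "ge > 1" "gi > 1" and U: "U \<in> admissible ge gi"
  shows "spec_entropy ge gi U =
    - 2 * ln (rho U) - ln (beta_e ge gi U) / (ge - 1) - ln (beta_i U) / (gi - 1)"
proof -
  have r: "rho U > 0" and pe: "p_e ge gi U > 0" and pion: "p_i U > 0"
    using U by (auto simp: admissible_def)
  show ?thesis
    unfolding spec_entropy_def beta_e_def beta_i_def
    using g r pe pion by (simp add: ln_div ln_powr divide_simps) (simp add: algebra_simps)
qed

lemma log_mean_jump: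
  assumes "q Ul > 0" "q Ur > 0"
  shows "log_mean q Ul Ur * (ln (q Ur) - ln (q Ul)) = q Ur - q Ul" "log_mean q Ul Ur > 0"
proof -
  have "(q Ur - q Ul) / (ln (q Ur) - ln (q Ul)) > 0" if "q Ur \<noteq> q Ul"
  proof (cases "q Ur > q Ul")
    case True then show ?thesis using assms by simp
  next
    case False
    then have "q Ur < q Ul" using that by simp
    then show ?thesis using assms by (simp add: divide_neg_neg)
  qed
  then show "log_mean q Ul Ur > 0" using assms by (auto simp: log_mean_def)
  show "log_mean q Ul Ur * (ln (q Ur) - ln (q Ul)) = q Ur - q Ul"
    using assms by (auto simp: log_mean_def)
qed

text \<open>
  By \<open>spec_entropy_beta\<close>, the specific entropy is linear in the logarithms of \<open>\<rho>\<close>, \<open>\<beta>\<^sub>e\<close> and \<open>\<beta>\<^sub>i\<close>;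
  the logarithmic means in the flux convert the jumps of these logarithms into jumps of the quantities.
  The mean values of the remaining factors are those of the discrete product rule
  \<open>a\<^sub>r b\<^sub>r - a\<^sub>l b\<^sub>l = a (b\<^sub>r - b\<^sub>l) + b (a\<^sub>r - a\<^sub>l)\<close>, where \<open>a\<close> and \<open>b\<close> denote arithmetic means.
\<close>

lemma num_flux_x_jump:
  assumes g: "ge > 1" "gi > 1" and Ul: "Ul \<in> admissible ge gi" and Ur: "Ur \<in> admissible ge gi"
  shows "(entropy_var ge gi Ur - entropy_var ge gi Ul) \<bullet> num_flux_x ge gi Ul Ur
    = potential_x ge gi Ur - potential_x ge gi Ul"
proof -
  have pos: "rho W > 0" "beta_e ge gi W > 0" "beta_i W > 0" if "W \<in> admissible ge gi" for W
    using that by (auto simp: admissible_def beta_e_def beta_i_def)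
  define R Be Bi where "R = log_mean rho Ul Ur" and "Be = log_mean (beta_e ge gi) Ul Ur"
    and "Bi = log_mean beta_i Ul Ur"
  define lr where "lr = ln (rho Ur) - ln (rho Ul)"
  define le where "le = ln (beta_e ge gi Ur) - ln (beta_e ge gi Ul)"
  define li where "li = ln (beta_i Ur) - ln (beta_i Ul)"
  define k where "k = 1 / (ge - 1)"
  define l where "l = 1 / (gi - 1)"
  have R: "R * lr = rho Ur - rho Ul" "R > 0"
    unfolding R_def lr_def using log_mean_jump[of rho Ul Ur] pos Ul Ur by auto
  have Be: "Be * le = beta_e ge gi Ur - beta_e ge gi Ul" "Be > 0"
    unfolding Be_def le_def using log_mean_jump[of "beta_e ge gi" Ul Ur] pos Ul Ur by auto
  have Bi: "Bi * li = beta_i Ur - beta_i Ul" "Bi > 0"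
    unfolding Bi_def li_def using log_mean_jump[of beta_i Ul Ur] pos Ul Ur by auto
  have s: "spec_entropy ge gi Ur - spec_entropy ge gi Ul = - 2 * lr - k * le - l * li"
    unfolding spec_entropy_beta[OF g Ul] spec_entropy_beta[OF g Ur] lr_def le_def li_def
      k_def l_def by (simp add: diff_divide_distrib)
  have V1: "(entropy_var ge gi Ur - entropy_var ge gi Ul) $ 1 = 2 * lr + k * le + l * li
     - (beta_e ge gi Ur * vel_sq Ur - beta_e ge gi Ul * vel_sq Ul) / 2"
    using s by (simp add: entropy_var_def diff_divide_distrib)
  have bpos: "beta_e ge gi Ul + beta_e ge gi Ur > 0" using pos Ul Ur by (simp add: add_pos_pos)
  define N where "N = avg rho Ul Ur / avg (beta_e ge gi) Ul Ur"
  have NN: "N * (beta_e ge gi Ul + beta_e ge gi Ur) = rho Ul + rho Ur"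
    using bpos by (simp add: N_def avg_def field_simps)
  define A D where "A = 1 / Be" and "D = 1 / Bi"
  have le: "le = A * (beta_e ge gi Ur - beta_e ge gi Ul)"
    using Be by (simp add: A_def field_simps)
  have li: "li = D * (beta_i Ur - beta_i Ul)"
    using Bi by (simp add: D_def field_simps)
  define f where "f = R * ((vel_x Ul + vel_x Ur) / 2)"
  define f2 where "f2 = 2 * N + (vel_x Ul + vel_x Ur) / 2 * f"
  have F: "num_flux_x ge gi Ul Ur $ 1 = f"
    "num_flux_x ge gi Ul Ur $ 2 = f2"
    "num_flux_x ge gi Ul Ur $ 3 = (vel_y Ul + vel_y Ur) / 2 * f"
    "num_flux_x ge gi Ul Ur $ 5 = D * f"
    "num_flux_x ge gi Ul Ur $ 4 = (k * A - (vel_sq Ul + vel_sq Ur) / 4) * f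
      + (vel_x Ul + vel_x Ur) / 2 * f2 + (vel_y Ul + vel_y Ur) / 2 * ((vel_y Ul + vel_y Ur) / 2 * f)
      + l * (D * f)"
    by (simp_all add: num_flux_x_def Let_def f2_def f_def N_def R_def A_def D_def k_def l_def
        Be_def Bi_def avg_def)
  have V: "(entropy_var ge gi Ur - entropy_var ge gi Ul) $ 1 =
      2 * lr + k * (A * (beta_e ge gi Ur - beta_e ge gi Ul)) + l * (D * (beta_i Ur - beta_i Ul))
      - (beta_e ge gi Ur * vel_sq Ur - beta_e ge gi Ul * vel_sq Ul) / 2"
    "(entropy_var ge gi Ur - entropy_var ge gi Ul) $ 2 =
      beta_e ge gi Ur * vel_x Ur - beta_e ge gi Ul * vel_x Ul"
    "(entropy_var ge gi Ur - entropy_var ge gi Ul) $ 3 =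
      beta_e ge gi Ur * vel_y Ur - beta_e ge gi Ul * vel_y Ul"
    "(entropy_var ge gi Ur - entropy_var ge gi Ul) $ 4 = - (beta_e ge gi Ur - beta_e ge gi Ul)"
    "(entropy_var ge gi Ur - entropy_var ge gi Ul) $ 5 =
      l * ((beta_e ge gi Ur - beta_e ge gi Ul) - (beta_i Ur - beta_i Ul))"
    unfolding V1 le li
    by (simp_all add: entropy_var_def l_def diff_divide_distrib)
  \<comment> \<open>Everything cancels except the pressure term of \<open>f2\<close> and the density part of the first component.\<close>
  have "(entropy_var ge gi Ur - entropy_var ge gi Ul) \<bullet> num_flux_x ge gi Ul Ur
    = N * (beta_e ge gi Ul + beta_e ge gi Ur) * (vel_x Ur - vel_x Ul)
      + (R * lr) * (vel_x Ul + vel_x Ur)"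
    unfolding inner_vec_def sum_5 inner_real_def F V f2_def f_def vel_sq_def
    by (simp add: field_simps power2_eq_square)
  then show ?thesis
    unfolding NN R potential_x_eq[OF g Ul] potential_x_eq[OF g Ur]
    by (simp add: algebra_simps)
qed

text \<open>
  Each one-sided entropy variable is the mean of both minus or plus half the jump, and the jump
  contributes half the jump of the potential.
\<close>

lemma entropy_var_num_flux_x:
  assumes g: "ge > 1" "gi > 1" and Ul: "Ul \<in> admissible ge gi" and Ur: "Ur \<in> admissible ge gi"
  shows "entropy_var ge gi Ul \<bullet> num_flux_x ge gi Ul Ur = num_entropy_flux_x ge gi Ul Ur + potential_x ge gi Ul"
    and "entropy_var ge gi Ur \<bullet> num_flux_x ge gi Ul Ur = num_entropy_flux_x ge gi Ul Ur + potential_x ge gi Ur"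
  using num_flux_x_jump[OF assms]
  by (simp_all add: num_entropy_flux_x_def avg_def inner_diff_left inner_add_left field_simps)

lemma entropy_var_num_flux_y:
  assumes g: "ge > 1" "gi > 1" and Ul: "Ul \<in> admissible ge gi" and Ur: "Ur \<in> admissible ge gi"
  shows "entropy_var ge gi Ul \<bullet> num_flux_y ge gi Ul Ur = num_entropy_flux_y ge gi Ul Ur + potential_y ge gi Ul"
    and "entropy_var ge gi Ur \<bullet> num_flux_y ge gi Ul Ur = num_entropy_flux_y ge gi Ul Ur + potential_y ge gi Ur"
  using entropy_var_num_flux_x[of ge gi "swap_xy Ul" "swap_xy Ur"] assms
  by (simp_all add: num_flux_y_swap num_entropy_flux_y_swap potential_y_swap entropy_var_swap
      inner_swap_left)

lemma entropy_var_C_y: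
  assumes "ge > 1" "gi > 1" and "U \<in> admissible ge gi"
  shows "entropy_var ge gi U \<bullet> (C_y ge gi U *v w) = 0"
  using entropy_var_C_x[of ge gi "swap_xy U" "swap_xy w"] assms
  by (simp add: C_y_swap entropy_var_swap inner_swap_left)

lemma scheme_entropy_balance:
  assumes g: "ge > 1" "gi > 1" and adm: "\<And>k l. (k, l) \<in> stencil i j \<Longrightarrow> u k l \<in> admissible ge gi"
  shows "scheme_rhs ge gi dx dy u i j \<bullet> entropy_var ge gi (u i j) =
    - (num_entropy_flux_x ge gi (u i j) (u (i + 1) j)
       - num_entropy_flux_x ge gi (u (i - 1) j) (u i j)) / dx
    - (num_entropy_flux_y ge gi (u i j) (u i (j + 1))
       - num_entropy_flux_y ge gi (u i (j - 1)) (u i j)) / dy"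
proof -
  have a: "u i j \<in> admissible ge gi" "u (i + 1) j \<in> admissible ge gi" "u (i - 1) j \<in> admissible ge gi"
    "u i (j + 1) \<in> admissible ge gi" "u i (j - 1) \<in> admissible ge gi"
    by (rule adm, simp add: stencil_def)+
  show ?thesis
    unfolding scheme_rhs_def inner_commute[of _ "entropy_var ge gi (u i j)"]
    by (simp add: inner_diff_right entropy_var_C_x[OF g a(1)] entropy_var_C_y[OF g a(1)]
        entropy_var_num_flux_x(1)[OF g a(1,2)] entropy_var_num_flux_x(2)[OF g a(3,1)]
        entropy_var_num_flux_y(1)[OF g a(1,4)] entropy_var_num_flux_y(2)[OF g a(5,1)] inverse_eq_divide diff_divide_distrib)
qed

section \<open>Second order expansions, uniform on compact sets\<close>

text \<open>
  Convergence \<open>h \<longlongrightarrow> 0\<close>, uniformly in \<open>p \<in> K\<close>.  The neighbourhood filter contains \<open>h = 0\<close>, so that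
  \<open>O(h\<^sup>3)\<close> for this filter also pins down the value at \<open>0\<close>.
\<close>

definition unif_nhds_0 :: "'p set \<Rightarrow> ('p \<times> real) filter" where
  "unif_nhds_0 K = principal K \<times>\<^sub>F nhds 0"

lemma eventually_unif_nhds_0:
  "eventually P (unif_nhds_0 K) \<longleftrightarrow> (\<exists>\<delta>>0. \<forall>p\<in>K. \<forall>h. \<bar>h\<bar> < \<delta> \<longrightarrow> P (p, h))"
proof
  assume "eventually P (unif_nhds_0 K)"
  then obtain Q R where Q: "\<forall>p\<in>K. Q p" and R: "eventually R (nhds (0::real))"
    and QR: "\<And>p h. Q p \<Longrightarrow> R h \<Longrightarrow> P (p, h)"
    unfolding unif_nhds_0_def eventually_prod_filter eventually_principal by blast
  from R obtain \<delta> where "\<delta> > 0" "\<And>h. \<bar>h\<bar> < \<delta> \<Longrightarrow> R h"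
    unfolding eventually_nhds_metric dist_real_def by auto
  then show "\<exists>\<delta>>0. \<forall>p\<in>K. \<forall>h. \<bar>h\<bar> < \<delta> \<longrightarrow> P (p, h)"
    using Q QR by blast
next
  assume "\<exists>\<delta>>0. \<forall>p\<in>K. \<forall>h. \<bar>h\<bar> < \<delta> \<longrightarrow> P (p, h)"
  then obtain \<delta> where d: "\<delta> > 0" "\<forall>p\<in>K. \<forall>h. \<bar>h\<bar> < \<delta> \<longrightarrow> P (p, h)" by blast
  have "eventually (\<lambda>h. \<bar>h\<bar> < \<delta>) (nhds (0::real))"
    using d(1) unfolding eventually_nhds_metric dist_real_def by auto
  then show "eventually P (unif_nhds_0 K)"
    unfolding unif_nhds_0_def eventually_prod_filter eventually_principal
    using d(2) by (intro exI[of _ "\<lambda>p. p \<in> K"] exI[of _ "\<lambda>h. \<bar>h\<bar> < \<delta>"]) auto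
qed

lemma tendsto_snd_unif_nhds_0: "(snd \<longlongrightarrow> 0) (unif_nhds_0 K)"
  unfolding unif_nhds_0_def filterlim_def by (rule filtermap_snd_prod_filter)

lemma bigo_coeff:
  assumes "compact K" "continuous_on K a"
  shows "(\<lambda>z. a (fst z)) \<in> O[unif_nhds_0 K](\<lambda>_. 1 :: real)"
proof -
  obtain M where "\<And>p. p \<in> K \<Longrightarrow> norm (a p) \<le> M"
    using compact_imp_bounded[OF compact_continuous_image[OF assms(2,1)]]
    unfolding bounded_iff by auto
  then show ?thesis
    by (intro bigoI[of _ M]) (auto simp: eventually_unif_nhds_0 intro!: exI[of _ 1])
qed

lemma bigo_snd: "snd \<in> O[unif_nhds_0 K](\<lambda>_. 1 :: real)"
  by (intro bigoI[of _ 1]) (auto simp: eventually_unif_nhds_0 intro!: exI[of _ 1])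

text \<open>
  The coefficients are required to be continuous, because on a compact set this yields all the
  bounds needed for products and, away from zero, for quotients.
\<close>

definition taylor2 :: "'p::topological_space set \<Rightarrow> ('p \<Rightarrow> real \<Rightarrow> real) \<Rightarrow>
    ('p \<Rightarrow> real) \<Rightarrow> ('p \<Rightarrow> real) \<Rightarrow> ('p \<Rightarrow> real) \<Rightarrow> bool" where
  "taylor2 K g a b c \<longleftrightarrow> continuous_on K a \<and> continuous_on K b \<and> continuous_on K c \<and>
     (\<lambda>z. g (fst z) (snd z) - (a (fst z) + b (fst z) * snd z + c (fst z) * (snd z)\<^sup>2))
       \<in> O[unif_nhds_0 K](\<lambda>z. snd z ^ 3)"

lemma taylor2_bound:
  assumes "taylor2 K g a b c"
  obtains M \<delta> where "\<delta> > 0"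
    "\<And>p h. p \<in> K \<Longrightarrow> \<bar>h\<bar> < \<delta> \<Longrightarrow> \<bar>g p h - (a p + b p * h + c p * h\<^sup>2)\<bar> \<le> M * \<bar>h\<bar> ^ 3"
proof -
  obtain M where "eventually (\<lambda>z. \<bar>g (fst z) (snd z) -
      (a (fst z) + b (fst z) * snd z + c (fst z) * (snd z)\<^sup>2)\<bar> \<le> M * \<bar>snd z ^ 3\<bar>) (unif_nhds_0 K)"
    using assms unfolding taylor2_def by (auto elim!: landau_o.bigE)
  then show ?thesis
    using that unfolding eventually_unif_nhds_0 by (auto simp: power_abs)
qed

lemma taylor2_cong:
  assumes "taylor2 K f a b c"
    and "eventually (\<lambda>z. f (fst z) (snd z) = g (fst z) (snd z)) (unif_nhds_0 K)"
    and coeff: "\<And>p. p \<in> K \<Longrightarrow> a p = a' p" "\<And>p. p \<in> K \<Longrightarrow> b p = b' p" "\<And>p. p \<in> K \<Longrightarrow> c p = c' p"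
  shows "taylor2 K g a' b' c'"
proof -
  have "eventually (\<lambda>z. fst z \<in> K) (unif_nhds_0 K)"
    by (auto simp: eventually_unif_nhds_0 intro!: exI[of _ 1])
  with assms(2) have "eventually (\<lambda>z.
      f (fst z) (snd z) - (a (fst z) + b (fst z) * snd z + c (fst z) * (snd z)\<^sup>2) =
      g (fst z) (snd z) - (a' (fst z) + b' (fst z) * snd z + c' (fst z) * (snd z)\<^sup>2)) (unif_nhds_0 K)"
    by eventually_elim (simp add: coeff)
  then have "(\<lambda>z. f (fst z) (snd z) - (a (fst z) + b (fst z) * snd z + c (fst z) * (snd z)\<^sup>2))
      \<in> O[unif_nhds_0 K](\<lambda>z. snd z ^ 3)
    \<longleftrightarrow> (\<lambda>z. g (fst z) (snd z) - (a' (fst z) + b' (fst z) * snd z + c' (fst z) * (snd z)\<^sup>2))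
      \<in> O[unif_nhds_0 K](\<lambda>z. snd z ^ 3)"
    by (rule landau_o.big.in_cong)
  moreover have "continuous_on K a' = continuous_on K a" "continuous_on K b' = continuous_on K b"
    "continuous_on K c' = continuous_on K c"
    by (rule continuous_on_cong; simp add: coeff)+
  ultimately show ?thesis using assms(1) by (simp add: taylor2_def)
qed

lemma taylor2_at_0:
  assumes "taylor2 K g a b c" "p \<in> K"
  shows "g p 0 = a p"
proof -
  obtain M \<delta> where d: "\<delta> > 0"
    "\<And>p h. p \<in> K \<Longrightarrow> \<bar>h\<bar> < \<delta> \<Longrightarrow> \<bar>g p h - (a p + b p * h + c p * h\<^sup>2)\<bar> \<le> M * \<bar>h\<bar> ^ 3"
    by (rule taylor2_bound[OF assms(1)]) (rule that)
  then show ?thesis using d(2)[OF assms(2), of 0] by simp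
qed

lemma taylor2_derivative:
  assumes "taylor2 K g a b c" "p \<in> K"
  shows "(g p has_real_derivative b p) (at 0)"
proof -
  obtain M \<delta> where d: "\<delta> > 0"
    "\<And>p h. p \<in> K \<Longrightarrow> \<bar>h\<bar> < \<delta> \<Longrightarrow> \<bar>g p h - (a p + b p * h + c p * h\<^sup>2)\<bar> \<le> M * \<bar>h\<bar> ^ 3"
    by (rule taylor2_bound[OF assms(1)]) (rule that)
  have "((\<lambda>h. (g p h - g p 0) / h - (b p + c p * h)) \<longlongrightarrow> 0) (at 0)"
  proof (rule Lim_null_comparison)
    have "eventually (\<lambda>h. h \<noteq> 0 \<and> \<bar>h\<bar> < \<delta>) (at (0::real))"
      using d(1) by (auto simp: eventually_at intro!: exI[of _ \<delta>])
    then show "eventually (\<lambda>h. norm ((g p h - g p 0) / h - (b p + c p * h)) \<le> M * h\<^sup>2) (at 0)"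
    proof eventually_elim
      case (elim h)
      have "(g p h - g p 0) / h - (b p + c p * h) = (g p h - (a p + b p * h + c p * h\<^sup>2)) / h"
        using elim taylor2_at_0[OF assms] by (simp add: field_simps power2_eq_square)
      moreover have "\<bar>g p h - (a p + b p * h + c p * h\<^sup>2)\<bar> / \<bar>h\<bar> \<le> M * \<bar>h\<bar> ^ 3 / \<bar>h\<bar>"
        using elim d(2)[OF assms(2)] by (intro divide_right_mono) auto
      moreover have "M * \<bar>h\<bar> ^ 3 / \<bar>h\<bar> = M * h\<^sup>2"
        using elim by (simp add: power3_eq_cube power2_eq_square)
      ultimately show ?case by simp
    qed
    show "((\<lambda>h. M * h\<^sup>2) \<longlongrightarrow> 0) (at 0)"
      by (auto intro!: tendsto_eq_intros)
  qed
  moreover have "((\<lambda>h. b p + c p * h) \<longlongrightarrow> b p) (at 0)"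
    by (auto intro!: tendsto_eq_intros)
  ultimately have "((\<lambda>h. (g p h - g p 0) / h) \<longlongrightarrow> 0 + b p) (at 0)"
    using tendsto_add[of _ 0 "at 0" "\<lambda>h. b p + c p * h" "b p"] by fastforce
  then show ?thesis by (simp add: DERIV_def)
qed

lemma taylor2_central_difference:
  assumes "taylor2 K g a b c"
  shows "\<exists>M. \<exists>\<delta>>0. \<forall>p\<in>K. \<forall>h. 0 < h \<and> h < \<delta> \<longrightarrow>
    \<bar>(g p h - g p (- h)) / (2 * h) - b p\<bar> \<le> M * h\<^sup>2"
proof -
  obtain M \<delta> where d: "\<delta> > 0"
    "\<And>p h. p \<in> K \<Longrightarrow> \<bar>h\<bar> < \<delta> \<Longrightarrow> \<bar>g p h - (a p + b p * h + c p * h\<^sup>2)\<bar> \<le> M * \<bar>h\<bar> ^ 3"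
    by (rule taylor2_bound[OF assms(1)]) (rule that)
  have "\<bar>(g p h - g p (- h)) / (2 * h) - b p\<bar> \<le> M * h\<^sup>2" if "p \<in> K" "0 < h" "h < \<delta>" for p h
  proof -
    have "\<bar>g p h - (a p + b p * h + c p * h\<^sup>2)\<bar> \<le> M * h ^ 3"
      "\<bar>g p (- h) - (a p + b p * (- h) + c p * h\<^sup>2)\<bar> \<le> M * h ^ 3"
      using d(2)[of p h] d(2)[of p "- h"] that by auto
    then have "\<bar>g p h - g p (- h) - 2 * h * b p\<bar> \<le> 2 * (M * h ^ 3)"
      by (simp add: algebra_simps abs_le_iff)
    then have "\<bar>g p h - g p (- h) - 2 * h * b p\<bar> / (2 * h) \<le> 2 * (M * h ^ 3) / (2 * h)"
      using that by (intro divide_right_mono) auto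
    moreover have "(g p h - g p (- h) - 2 * h * b p) / (2 * h) = (g p h - g p (- h)) / (2 * h) - b p"
      using that by (simp add: field_simps)
    then have "\<bar>g p h - g p (- h) - 2 * h * b p\<bar> / (2 * h) = \<bar>(g p h - g p (- h)) / (2 * h) - b p\<bar>"
      using that by (metis abs_div_pos mult_pos_pos zero_less_numeral)
    moreover have "2 * (M * h ^ 3) / (2 * h) = M * h\<^sup>2"
      using that by (simp add: power3_eq_cube power2_eq_square)
    ultimately show ?thesis by simp
  qed
  then show ?thesis using d(1) by blast
qed

lemma taylor2_coeff:
  assumes "continuous_on K a"
  shows "taylor2 K (\<lambda>p h. a p) a (\<lambda>p. 0) (\<lambda>p. 0)"
  using assms by (simp add: taylor2_def)

lemma taylor2_add:
  assumes "taylor2 K f a b c" "taylor2 K g a' b' c'"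
  shows "taylor2 K (\<lambda>p h. f p h + g p h) (\<lambda>p. a p + a' p) (\<lambda>p. b p + b' p) (\<lambda>p. c p + c' p)"
proof -
  have "(\<lambda>z. f (fst z) (snd z) - (a (fst z) + b (fst z) * snd z + c (fst z) * (snd z)\<^sup>2)
        + (g (fst z) (snd z) - (a' (fst z) + b' (fst z) * snd z + c' (fst z) * (snd z)\<^sup>2)))
      \<in> O[unif_nhds_0 K](\<lambda>z. snd z ^ 3)"
    by (rule sum_in_bigo(1)) (use assms in \<open>simp_all add: taylor2_def\<close>)
  then show ?thesis
    using assms by (simp add: taylor2_def continuous_on_add algebra_simps)
qed

context
  fixes K :: "'p::topological_space set"
  assumes K: "compact K"
begin

lemma taylor2_poly_bigo:
  assumes "continuous_on K a" "continuous_on K b" "continuous_on K c"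
  shows "(\<lambda>z. a (fst z) + b (fst z) * snd z + c (fst z) * (snd z)\<^sup>2) \<in> O[unif_nhds_0 K](\<lambda>_. 1 :: real)"
proof -
  have h: "(\<lambda>z. snd z) \<in> O[unif_nhds_0 K](\<lambda>_. 1 :: real)"
    using bigo_snd[of K] by simp
  have h2: "(\<lambda>z. (snd z)\<^sup>2) \<in> O[unif_nhds_0 K](\<lambda>_. 1 :: real)"
    using landau_o.big_power[OF h, of 2] by simp
  show ?thesis
    by (rule sum_in_bigo(1)[OF sum_in_bigo(1)[OF bigo_coeff[OF K assms(1)]
      landau_o.big.mult_in_1[OF bigo_coeff[OF K assms(2)] h]]
      landau_o.big.mult_in_1[OF bigo_coeff[OF K assms(3)] h2]])
qed

lemma taylor2_bounded:
  assumes f: "taylor2 K f a b c"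
  shows "(\<lambda>z. f (fst z) (snd z)) \<in> O[unif_nhds_0 K](\<lambda>_. 1)"
proof -
  have h3: "(\<lambda>z. snd z ^ 3) \<in> O[unif_nhds_0 K](\<lambda>_. 1 :: real)"
    using landau_o.big_power[OF bigo_snd[of K], of 3] by simp
  have "(\<lambda>z. (f (fst z) (snd z) - (a (fst z) + b (fst z) * snd z + c (fst z) * (snd z)\<^sup>2))
      + (a (fst z) + b (fst z) * snd z + c (fst z) * (snd z)\<^sup>2)) \<in> O[unif_nhds_0 K](\<lambda>_. 1)"
    by (rule sum_in_bigo(1)[OF landau_o.big_trans[OF _ h3] taylor2_poly_bigo])
      (use f in \<open>simp_all add: taylor2_def\<close>)
  then show ?thesis by simp
qed

text \<open>
  The product of two quadratic polynomials exceeds its second order part by \<open>h\<^sup>3\<close> times a bounded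
  function; all other contributions contain a remainder as a factor.
\<close>

lemma taylor2_mult:
  assumes f: "taylor2 K f a b c" and g: "taylor2 K g a' b' c'"
  shows "taylor2 K (\<lambda>p h. f p h * g p h) (\<lambda>p. a p * a' p) (\<lambda>p. a p * b' p + b p * a' p)
    (\<lambda>p. a p * c' p + b p * b' p + c p * a' p)"
proof -
  have f': "continuous_on K a" "continuous_on K b" "continuous_on K c"
    and g': "continuous_on K a'" "continuous_on K b'" "continuous_on K c'"
    using f g by (auto simp: taylor2_def)
  define P where "P z = a (fst z) + b (fst z) * snd z + c (fst z) * (snd z)\<^sup>2" for z
  define P' where "P' z = a' (fst z) + b' (fst z) * snd z + c' (fst z) * (snd z)\<^sup>2" for z
  define Q where "Q z = (b (fst z) * c' (fst z) + c (fst z) * b' (fst z))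
    + c (fst z) * c' (fst z) * snd z + 0 * (snd z)\<^sup>2" for z
  have P: "P \<in> O[unif_nhds_0 K](\<lambda>_. 1)"
    unfolding P_def using f' by (rule taylor2_poly_bigo)
  have Q: "Q \<in> O[unif_nhds_0 K](\<lambda>_. 1)"
    unfolding Q_def
    by (rule taylor2_poly_bigo[of "\<lambda>p. b p * c' p + c p * b' p" "\<lambda>p. c p * c' p" "\<lambda>_. 0"])
      (use f' g' in \<open>auto intro!: continuous_on_add continuous_on_mult\<close>)
  have 1: "(\<lambda>z. (f (fst z) (snd z) - P z) * g (fst z) (snd z)) \<in> O[unif_nhds_0 K](\<lambda>z. snd z ^ 3 * 1)"
    using f by (intro landau_o.big.mult taylor2_bounded[OF g]) (simp add: taylor2_def P_def)
  have 2: "(\<lambda>z. (g (fst z) (snd z) - P' z) * P z) \<in> O[unif_nhds_0 K](\<lambda>z. snd z ^ 3 * 1)"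
    using g by (intro landau_o.big.mult P) (simp add: taylor2_def P'_def)
  have 3: "(\<lambda>z. snd z ^ 3 * Q z) \<in> O[unif_nhds_0 K](\<lambda>z. snd z ^ 3 * 1)"
    by (intro landau_o.big.mult Q) simp
  have "(\<lambda>z. (f (fst z) (snd z) - P z) * g (fst z) (snd z)
      + (g (fst z) (snd z) - P' z) * P z + snd z ^ 3 * Q z) \<in> O[unif_nhds_0 K](\<lambda>z. snd z ^ 3)"
    using sum_in_bigo(1)[OF sum_in_bigo(1)[OF 1 2] 3] by simp
  moreover have "(f (fst z) (snd z) - P z) * g (fst z) (snd z)
      + (g (fst z) (snd z) - P' z) * P z + snd z ^ 3 * Q z =
    f (fst z) (snd z) * g (fst z) (snd z) - (a (fst z) * a' (fst z)
      + (a (fst z) * b' (fst z) + b (fst z) * a' (fst z)) * snd z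
       + (a (fst z) * c' (fst z) + b (fst z) * b' (fst z) + c (fst z) * a' (fst z)) * (snd z)\<^sup>2)" for z
    by (simp add: P_def P'_def Q_def algebra_simps power2_eq_square power3_eq_cube)
  ultimately show ?thesis
    using f' g' unfolding taylor2_def by (auto intro!: continuous_on_add continuous_on_mult)
qed

lemma taylor2_cmult:
  assumes "taylor2 K f a b c"
  shows "taylor2 K (\<lambda>p h. k * f p h) (\<lambda>p. k * a p) (\<lambda>p. k * b p) (\<lambda>p. k * c p)"
  using taylor2_mult[OF taylor2_coeff[OF continuous_on_const[of K k]] assms] by simp

lemma taylor2_increment_bigo:
  assumes f: "taylor2 K f a b c"
  shows "(\<lambda>z. f (fst z) (snd z) - a (fst z)) \<in> O[unif_nhds_0 K](snd)"
proof -
  have f': "continuous_on K a" "continuous_on K b" "continuous_on K c"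
    using f by (auto simp: taylor2_def)
  have h: "(\<lambda>z. snd z) \<in> O[unif_nhds_0 K](\<lambda>_. 1 :: real)"
    using bigo_snd[of K] by simp
  have "(\<lambda>z. snd z * (snd z * snd z)) \<in> O[unif_nhds_0 K](\<lambda>z. snd z * 1)"
    by (intro landau_o.big.mult landau_o.big.mult_in_1 h) simp
  then have h3: "(\<lambda>z. snd z ^ 3) \<in> O[unif_nhds_0 K](\<lambda>z. snd z)"
    by (simp add: power3_eq_cube mult.assoc)
  have "(\<lambda>z. b (fst z) + c (fst z) * snd z + 0 * (snd z)\<^sup>2) \<in> O[unif_nhds_0 K](\<lambda>_. 1)"
    using f' taylor2_poly_bigo[of b c "\<lambda>_. 0"] by simp
  then have "(\<lambda>z. snd z * (b (fst z) + c (fst z) * snd z + 0 * (snd z)\<^sup>2)) \<in> O[unif_nhds_0 K](\<lambda>z. snd z * 1)"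
    by (rule landau_o.big.mult[OF landau_o.big_refl])
  then have "(\<lambda>z. snd z * (b (fst z) + c (fst z) * snd z)) \<in> O[unif_nhds_0 K](\<lambda>z. snd z)"
    by simp
  moreover have "(\<lambda>z. f (fst z) (snd z) - (a (fst z) + b (fst z) * snd z + c (fst z) * (snd z)\<^sup>2))
      \<in> O[unif_nhds_0 K](\<lambda>z. snd z)"
    by (rule landau_o.big_trans[OF _ h3]) (use f in \<open>simp add: taylor2_def\<close>)
  ultimately have "(\<lambda>z. snd z * (b (fst z) + c (fst z) * snd z) + 
    (f (fst z) (snd z) - (a (fst z) + b (fst z) * snd z + c (fst z) * (snd z)\<^sup>2)))
      \<in> O[unif_nhds_0 K](\<lambda>z. snd z)"
    by (rule sum_in_bigo)
  then show ?thesis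
    by (simp add: algebra_simps power2_eq_square)
qed

lemma taylor2_increment_tendsto:
  assumes f: "taylor2 K f a b c"
  shows "((\<lambda>z. f (fst z) (snd z) - a (fst z)) \<longlongrightarrow> 0) (unif_nhds_0 K)"
proof -
  have "snd \<in> o[unif_nhds_0 K](\<lambda>_. 1 :: real)"
    using tendsto_snd_unif_nhds_0 by (intro smalloI_tendsto) auto
  then have "(\<lambda>z. f (fst z) (snd z) - a (fst z)) \<in> o[unif_nhds_0 K](\<lambda>_. 1)"
    by (rule landau_o.big_small_trans[OF taylor2_increment_bigo[OF f]])
  from smalloD_tendsto[OF this] show ?thesis by simp
qed

lemma taylor2_normalize:
  assumes f: "taylor2 K f a b c" and nz: "\<And>p. p \<in> K \<Longrightarrow> a p \<noteq> 0"
  shows "taylor2 K (\<lambda>p h. f p h / a p) (\<lambda>p. 1) (\<lambda>p. b p / a p) (\<lambda>p. c p / a p)"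
proof -
  have "continuous_on K a" using f by (simp add: taylor2_def)
  then have "continuous_on K (\<lambda>p. inverse (a p))"
    using nz by (intro continuous_on_inverse) auto
  from taylor2_mult[OF f taylor2_coeff[OF this]] show ?thesis
    by (rule taylor2_cong) (auto simp: nz divide_inverse)
qed

text \<open>
  Substitution into a function of one real variable.  Dividing by the value at \<open>h = 0\<close> reduces inverse
  and logarithmic mean to functions near \<open>1\<close> with the value \<open>1\<close> there, so that a single
  expansion serves for all base points.
\<close>

lemma taylor2_compose:
  assumes f: "taylor2 K f (\<lambda>p. 1) b c"
    and \<phi>: "(\<lambda>w. \<phi> (1 + w) - (1 + k * w + l * w\<^sup>2)) \<in> O[at 0](\<lambda>w. w ^ 3)" and \<phi>1: "\<phi> 1 = (1::real)"
  shows "\<exists>c'. taylor2 K (\<lambda>p h. \<phi> (f p h)) (\<lambda>p. 1) (\<lambda>p. k * b p) c'"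
proof -
  define w where "w = (\<lambda>p h. f p h - 1)"
  have w: "taylor2 K w (\<lambda>p. 0) b c"
    using taylor2_add[OF f taylor2_coeff[of K "\<lambda>_. -1"]] by (simp add: w_def)
  have w0: "filterlim (\<lambda>z. w (fst z) (snd z)) (nhds 0) (unif_nhds_0 K)"
    using taylor2_increment_tendsto[OF w] by simp
  obtain M where M: "eventually (\<lambda>w. norm (\<phi> (1 + w) - (1 + k * w + l * w\<^sup>2)) \<le> M * norm (w ^ 3)) (at 0)"
    using \<phi> by (auto elim!: landau_o.bigE)
  have "eventually (\<lambda>w. norm (\<phi> (1 + w) - (1 + k * w + l * w\<^sup>2)) \<le> M * norm (w ^ 3)) (nhds 0)"
  proof (rule eventually_mono[OF M[unfolded eventually_at_filter]])
    fix x :: real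
    assume "x \<noteq> 0 \<longrightarrow> x \<in> UNIV \<longrightarrow> norm (\<phi> (1 + x) - (1 + k * x + l * x\<^sup>2)) \<le> M * norm (x ^ 3)"
    then show "norm (\<phi> (1 + x) - (1 + k * x + l * x\<^sup>2)) \<le> M * norm (x ^ 3)"
      using \<phi>1 by (cases "x = 0") auto
  qed
  then have "(\<lambda>z. \<phi> (1 + w (fst z) (snd z)) - (1 + k * w (fst z) (snd z) + l * (w (fst z) (snd z))\<^sup>2))
      \<in> O[unif_nhds_0 K](\<lambda>z. w (fst z) (snd z) ^ 3)"
    by (intro landau_o.big.compose[OF bigoI w0])
  also have "(\<lambda>z. w (fst z) (snd z) ^ 3) \<in> O[unif_nhds_0 K](\<lambda>z. snd z ^ 3)"
    using landau_o.big_power[OF taylor2_increment_bigo[OF w], of 3] by simp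
  finally have "taylor2 K (\<lambda>p h. \<phi> (1 + w p h) - (1 + k * w p h + l * (w p h)\<^sup>2))
      (\<lambda>_. 0) (\<lambda>_. 0) (\<lambda>_. 0)"
    by (simp add: taylor2_def)
  from taylor2_add[OF this taylor2_add[OF taylor2_add[OF taylor2_coeff[of K "\<lambda>_. 1"]
      taylor2_cmult[OF w]] taylor2_cmult[OF taylor2_mult[OF w w]]], of k l]
  show ?thesis
    by (auto simp: w_def power2_eq_square)
qed

lemma taylor2_inverse:
  assumes f: "taylor2 K f a b c" and nz: "\<And>p. p \<in> K \<Longrightarrow> a p \<noteq> 0"
  shows "\<exists>c'. taylor2 K (\<lambda>p h. inverse (f p h)) (\<lambda>p. inverse (a p)) (\<lambda>p. - b p / (a p)\<^sup>2) c'"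
proof -
  have "(\<lambda>w::real. inverse (1 + w) - (1 + (-1) * w + 1 * w\<^sup>2)) \<in> O[at 0](\<lambda>w. w ^ 3)"
    by real_asymp
  from taylor2_compose[OF taylor2_normalize[OF f nz] this]
  obtain c' where c: "taylor2 K (\<lambda>p h. inverse (f p h / a p)) (\<lambda>p. 1) (\<lambda>p. (-1) * (b p / a p)) c'"
    by auto
  have "continuous_on K a" using f by (simp add: taylor2_def)
  then have "continuous_on K (\<lambda>p. inverse (a p))"
    using nz by (intro continuous_on_inverse) auto
  from taylor2_mult[OF c taylor2_coeff[OF this]]
  have "taylor2 K (\<lambda>p h. inverse (f p h)) (\<lambda>p. inverse (a p)) (\<lambda>p. - b p / (a p)\<^sup>2)
      (\<lambda>p. c' p * inverse (a p))"
    by (rule taylor2_cong)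
      (auto simp: nz field_simps power2_eq_square eventually_unif_nhds_0 intro!: exI[of _ 1])
  then show ?thesis by - (rule exI)
qed

lemma taylor2_eventually_pos:
  assumes f: "taylor2 K f a b c" and pos: "\<And>p. p \<in> K \<Longrightarrow> a p > 0"
  shows "eventually (\<lambda>z. f (fst z) (snd z) > 0) (unif_nhds_0 K)"
proof -
  have nz: "a p \<noteq> 0" if "p \<in> K" for p using pos[OF that] by simp
  have "((\<lambda>z. f (fst z) (snd z) / a (fst z)) \<longlongrightarrow> 1) (unif_nhds_0 K)"
    using taylor2_increment_tendsto[OF taylor2_normalize[OF f nz]]
    by (subst Lim_null) simp
  then have "eventually (\<lambda>z. f (fst z) (snd z) / a (fst z) > 0) (unif_nhds_0 K)"
    by (rule order_tendstoD) simp
  moreover have "eventually (\<lambda>z. fst z \<in> K) (unif_nhds_0 K)"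
    by (auto simp: eventually_unif_nhds_0 intro!: exI[of _ 1])
  ultimately show ?thesis
    by eventually_elim (use pos in \<open>fastforce simp: zero_less_divide_iff\<close>)
qed

text \<open>
  The logarithmic mean is homogeneous: the mean of \<open>a\<close> and \<open>a (1 + w)\<close> is \<open>a w / ln (1 + w)\<close>.  The linear
  coefficient \<open>1/2\<close> in the expansion of \<open>w / ln (1 + w)\<close> is the one of the arithmetic mean.
\<close>

lemma taylor2_log_mean:
  assumes f: "taylor2 K f a b c" and pos: "\<And>p. p \<in> K \<Longrightarrow> a p > 0"
  shows "\<exists>c'. taylor2 K (\<lambda>p h. log_mean (f p) 0 h) a (\<lambda>p. b p / 2) c'"
proof -
  define \<phi> :: "real \<Rightarrow> real" where "\<phi> r = (if r = 1 then 1 else (r - 1) / ln r)" for r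
  have "(\<lambda>w::real. w / ln (1 + w) - (1 + w/2 - w^2/12)) \<in> O[at 0](\<lambda>w. w^3)"
    by real_asymp
  then have "(\<lambda>w. \<phi> (1 + w) - (1 + 1/2 * w + (-1/12) * w\<^sup>2)) \<in> O[at 0](\<lambda>w. w ^ 3)"
    by (rule landau_o.big.ev_eq_trans2[rotated]) (auto simp: \<phi>_def eventually_at_filter)
  note expansion = this
  have nz: "a p \<noteq> 0" if "p \<in> K" for p using pos[OF that] by simp
  have "\<phi> 1 = 1" by (simp add: \<phi>_def)
  from taylor2_compose[OF taylor2_normalize[OF f nz] expansion this] obtain c' where
    c: "taylor2 K (\<lambda>p h. \<phi> (f p h / a p)) (\<lambda>p. 1) (\<lambda>p. 1 / 2 * (b p / a p)) c'"
    by blast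
  have "continuous_on K a" using f by (simp add: taylor2_def)
  from taylor2_mult[OF c taylor2_coeff[OF this]]
  have "taylor2 K (\<lambda>p h. log_mean (f p) 0 h) a (\<lambda>p. b p / 2) (\<lambda>p. c' p * a p)"
  proof (rule taylor2_cong)
    have "eventually (\<lambda>z. fst z \<in> K) (unif_nhds_0 K)"
      by (auto simp: eventually_unif_nhds_0 intro!: exI[of _ 1])
    moreover have "eventually (\<lambda>z. f (fst z) (snd z) > 0) (unif_nhds_0 K)"
      by (rule taylor2_eventually_pos[OF f pos])
    ultimately show "eventually (\<lambda>z. \<phi> (f (fst z) (snd z) / a (fst z)) * a (fst z)
        = log_mean (f (fst z)) 0 (snd z)) (unif_nhds_0 K)"
    proof eventually_elim
      case (elim z)
      have "a (fst z) > 0" using elim pos by auto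
      then show ?case
        using elim(2) by (auto simp: \<phi>_def log_mean_def taylor2_at_0[OF f elim(1)] ln_div field_simps)
    qed
  qed (use pos in fastforce)+
  then show ?thesis by - (rule exI)
qed

end

section \<open>Quantities and their two-point means\<close>

definition smooth2 :: "'p::topological_space set \<Rightarrow> ('p \<Rightarrow> real \<Rightarrow> real) \<Rightarrow> bool" where
  "smooth2 K f \<longleftrightarrow> (\<exists>a b c. taylor2 K f a b c)"

text \<open>
  Here \<open>f\<close> is a quantity along a line and \<open>g\<close> a two-point mean of it, between the
  parameters \<open>0\<close> and \<open>h\<close>.  No relation between the quadratic coefficients is imposed, as the
  various means differ there.
\<close>

definition half_slope :: "'p::topological_space set \<Rightarrow> ('p \<Rightarrow> real \<Rightarrow> real) \<Rightarrow> ('p \<Rightarrow> real \<Rightarrow> real) \<Rightarrow> bool"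
  where
  "half_slope K f g \<longleftrightarrow> (\<exists>a b c c'. taylor2 K f a (\<lambda>p. 2 * b p) c \<and> taylor2 K g a b c')"

lemma smooth2_imp_taylor2:
  assumes "smooth2 K f"
  obtains b c where "taylor2 K f (\<lambda>p. f p 0) b c"
proof -
  obtain a b c where f: "taylor2 K f a b c" using assms by (auto simp: smooth2_def)
  from f have "taylor2 K f (\<lambda>p. f p 0) b c"
    by (rule taylor2_cong) (simp_all add: taylor2_at_0[OF f])
  then show ?thesis by (rule that)
qed

lemma half_slope_imp_taylor2:
  assumes "half_slope K f g"
  obtains b c c' where "taylor2 K f (\<lambda>p. f p 0) (\<lambda>p. 2 * b p) c" "taylor2 K g (\<lambda>p. f p 0) b c'"
proof -
  obtain a b c c' where f: "taylor2 K f a (\<lambda>p. 2 * b p) c" and g: "taylor2 K g a b c'"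
    using assms by (auto simp: half_slope_def)
  from f have "taylor2 K f (\<lambda>p. f p 0) (\<lambda>p. 2 * b p) c"
    by (rule taylor2_cong) (simp_all add: taylor2_at_0[OF f])
  moreover from g have "taylor2 K g (\<lambda>p. f p 0) b c'"
    by (rule taylor2_cong) (simp_all add: taylor2_at_0[OF f])
  ultimately show ?thesis by (rule that)
qed

lemma half_slopeI:
  assumes "taylor2 K f a b c" "taylor2 K g a b' c'" "\<And>p. p \<in> K \<Longrightarrow> b p = 2 * b' p"
  shows "half_slope K f g"
  unfolding half_slope_def
  using taylor2_cong[OF assms(1), of f a "\<lambda>p. 2 * b' p" c] assms(2,3) by auto

lemma smooth2_left: "half_slope K f g \<Longrightarrow> smooth2 K f"
  by (auto simp: half_slope_def smooth2_def)

lemma half_slope_const: "half_slope K (\<lambda>p h. k) (\<lambda>p h. k)"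
  using taylor2_coeff[OF continuous_on_const[of K k]] by (rule half_slopeI[OF _ taylor2_coeff]) auto

lemma half_slope_add:
  assumes "half_slope K f g" "half_slope K f' g'"
  shows "half_slope K (\<lambda>p h. f p h + f' p h) (\<lambda>p h. g p h + g' p h)"
proof -
  obtain a b c c' d where "taylor2 K f a (\<lambda>p. 2 * b p) c" "taylor2 K g a b d"
    using assms(1) by (auto simp: half_slope_def)
  moreover obtain a' b' c' d' where "taylor2 K f' a' (\<lambda>p. 2 * b' p) c'" "taylor2 K g' a' b' d'"
    using assms(2) by (auto simp: half_slope_def)
  ultimately show ?thesis
    by (intro half_slopeI[OF taylor2_add taylor2_add]) auto
qed

context
  fixes K :: "'p::topological_space set"
  assumes K: "compact K"
begin

lemma half_slope_mult:
  assumes "half_slope K f g" "half_slope K f' g'"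
  shows "half_slope K (\<lambda>p h. f p h * f' p h) (\<lambda>p h. g p h * g' p h)"
proof -
  obtain a b c c' d where "taylor2 K f a (\<lambda>p. 2 * b p) c" "taylor2 K g a b d"
    using assms(1) by (auto simp: half_slope_def)
  moreover obtain a' b' c' d' where "taylor2 K f' a' (\<lambda>p. 2 * b' p) c'" "taylor2 K g' a' b' d'"
    using assms(2) by (auto simp: half_slope_def)
  ultimately show ?thesis
    by (intro half_slopeI[OF taylor2_mult[OF K] taylor2_mult[OF K]]) (auto simp: algebra_simps)
qed

lemma half_slope_diff:
  assumes "half_slope K f g" "half_slope K f' g'"
  shows "half_slope K (\<lambda>p h. f p h - f' p h) (\<lambda>p h. g p h - g' p h)"
  using half_slope_add[OF assms(1) half_slope_mult[OF half_slope_const[of K "-1"] assms(2)]] by simp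

lemma half_slope_divide:
  assumes "half_slope K f g" "half_slope K f' g'" and nz: "\<And>p. p \<in> K \<Longrightarrow> f' p 0 \<noteq> 0"
  shows "half_slope K (\<lambda>p h. f p h / f' p h) (\<lambda>p h. g p h / g' p h)"
proof -
  obtain b c c' where f: "taylor2 K f' (\<lambda>p. f' p 0) (\<lambda>p. 2 * b p) c"
    and g: "taylor2 K g' (\<lambda>p. f' p 0) b c'"
    using assms(2) by (rule half_slope_imp_taylor2)
  obtain d where "taylor2 K (\<lambda>p h. inverse (f' p h)) (\<lambda>p. inverse (f' p 0))
      (\<lambda>p. - (2 * b p) / (f' p 0)\<^sup>2) d"
    using taylor2_inverse[OF K f nz] by blast
  moreover obtain d' where "taylor2 K (\<lambda>p h. inverse (g' p h)) (\<lambda>p. inverse (f' p 0))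
      (\<lambda>p. - b p / (f' p 0)\<^sup>2) d'"
    using taylor2_inverse[OF K g nz] by blast
  ultimately have "half_slope K (\<lambda>p h. inverse (f' p h)) (\<lambda>p h. inverse (g' p h))"
    by (rule half_slopeI) simp
  from half_slope_mult[OF assms(1) this] show ?thesis
    by (simp add: divide_inverse)
qed

lemma half_slope_avg:
  assumes "smooth2 K f"
  shows "half_slope K f (\<lambda>p. avg (f p) 0)"
proof -
  obtain b c where f: "taylor2 K f (\<lambda>p. f p 0) b c"
    using assms by (rule smooth2_imp_taylor2)
  have "continuous_on K (\<lambda>p. f p 0)" using f by (simp add: taylor2_def)
  from taylor2_cmult[OF K taylor2_add[OF taylor2_coeff[OF this] f], of "1/2"]
  have "taylor2 K (\<lambda>p. avg (f p) 0) (\<lambda>p. f p 0) (\<lambda>p. b p / 2) (\<lambda>p. c p / 2)"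
    by (simp add: avg_def[abs_def])
  then show ?thesis
    by (rule half_slopeI[OF f]) simp
qed

lemma half_slope_log_mean:
  assumes "smooth2 K f" and pos: "\<And>p. p \<in> K \<Longrightarrow> f p 0 > 0"
  shows "half_slope K f (\<lambda>p. log_mean (f p) 0)"
proof -
  obtain b c where f: "taylor2 K f (\<lambda>p. f p 0) b c"
    using assms(1) by (rule smooth2_imp_taylor2)
  then obtain c' where "taylor2 K (\<lambda>p. log_mean (f p) 0) (\<lambda>p. f p 0) (\<lambda>p. b p / 2) c'"
    using taylor2_log_mean[OF K f pos] by blast
  then show ?thesis
    by (rule half_slopeI[OF f]) simp
qed

text \<open>
  Closure of \<open>smooth2\<close> is inherited from \<open>half_slope\<close>, since the arithmetic mean makes any
  smooth quantity the left component of a pair.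
\<close>

lemma smooth2_const: "smooth2 K (\<lambda>p h. k)"
  by (rule smooth2_left[OF half_slope_const])

lemma smooth2_add: "smooth2 K f \<Longrightarrow> smooth2 K g \<Longrightarrow> smooth2 K (\<lambda>p h. f p h + g p h)"
  by (rule smooth2_left[OF half_slope_add[OF half_slope_avg half_slope_avg]])

lemma smooth2_diff: "smooth2 K f \<Longrightarrow> smooth2 K g \<Longrightarrow> smooth2 K (\<lambda>p h. f p h - g p h)"
  by (rule smooth2_left[OF half_slope_diff[OF half_slope_avg half_slope_avg]])

lemma smooth2_mult: "smooth2 K f \<Longrightarrow> smooth2 K g \<Longrightarrow> smooth2 K (\<lambda>p h. f p h * g p h)"
  by (rule smooth2_left[OF half_slope_mult[OF half_slope_avg half_slope_avg]])

lemma smooth2_divide: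
  "smooth2 K f \<Longrightarrow> smooth2 K g \<Longrightarrow> (\<And>p. p \<in> K \<Longrightarrow> g p 0 \<noteq> 0) \<Longrightarrow> smooth2 K (\<lambda>p h. f p h / g p h)"
  by (rule smooth2_left[OF half_slope_divide[OF half_slope_avg half_slope_avg]])

text \<open>
  The quadratic terms are even in \<open>h\<close> and drop out.
\<close>

lemma half_slope_central_difference:
  assumes "half_slope K f g"
  shows "\<exists>M. \<exists>\<delta>>0. \<forall>p\<in>K. \<forall>h. 0 < h \<and> h < \<delta> \<longrightarrow>
    \<bar>(g p h - g p (- h)) / h - deriv (f p) 0\<bar> \<le> M * h\<^sup>2"
proof -
  obtain b c c' where f: "taylor2 K f (\<lambda>p. f p 0) (\<lambda>p. 2 * b p) c"
    and g: "taylor2 K g (\<lambda>p. f p 0) b c'"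
    using assms by (rule half_slope_imp_taylor2)
  have d: "deriv (f p) 0 = 2 * b p" if "p \<in> K" for p
    using taylor2_derivative[OF f that] by (rule DERIV_imp_deriv)
  obtain M \<delta> where M: "\<delta> > 0" "\<And>p h. p \<in> K \<Longrightarrow> 0 < h \<Longrightarrow> h < \<delta> \<Longrightarrow>
      \<bar>(g p h - g p (- h)) / (2 * h) - b p\<bar> \<le> M * h\<^sup>2"
    using taylor2_central_difference[OF g] by blast
  have "\<bar>(g p h - g p (- h)) / h - deriv (f p) 0\<bar> \<le> 2 * M * h\<^sup>2"
    if "p \<in> K" "0 < h" "h < \<delta>" for p h
  proof -
    have "(g p h - g p (- h)) / h - deriv (f p) 0 = 2 * ((g p h - g p (- h)) / (2 * h) - b p)"
      using d that by (simp add: field_simps)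
    then have "\<bar>(g p h - g p (- h)) / h - deriv (f p) 0\<bar> = 2 * \<bar>(g p h - g p (- h)) / (2 * h) - b p\<bar>"
      by (simp only: abs_mult abs_numeral)
    also have "\<dots> \<le> 2 * (M * h\<^sup>2)"
      by (rule mult_left_mono[OF M(2)[OF that]]) simp
    finally show ?thesis by (simp only: mult.assoc)
  qed
  then show ?thesis using M(1) by blast
qed

lemma smooth2_differentiable:
  assumes "smooth2 K f" "p \<in> K"
  shows "(f p has_real_derivative deriv (f p) 0) (at 0)"
proof -
  obtain b c where "taylor2 K f (\<lambda>p. f p 0) b c"
    using assms(1) by (rule smooth2_imp_taylor2)
  from taylor2_derivative[OF this assms(2)] show ?thesis
    using DERIV_imp_deriv by metis
qed

end

lemma smooth2_at_0:
  assumes "smooth2 K f"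
  shows "smooth2 K (\<lambda>p h. f p 0)"
proof -
  obtain b c where "taylor2 K f (\<lambda>p. f p 0) b c"
    using assms by (rule smooth2_imp_taylor2)
  then have "continuous_on K (\<lambda>p. f p 0)" by (simp add: taylor2_def)
  from taylor2_coeff[OF this] show ?thesis unfolding smooth2_def by blast
qed

lemma smooth2_eventually_pos:
  assumes "compact K" "smooth2 K f" "\<And>p. p \<in> K \<Longrightarrow> f p 0 > 0"
  shows "eventually (\<lambda>z. f (fst z) (snd z) > 0) (unif_nhds_0 K)"
proof -
  obtain b c where "taylor2 K f (\<lambda>p. f p 0) b c"
    using assms(2) by (rule smooth2_imp_taylor2)
  from taylor2_eventually_pos[OF assms(1) this] show ?thesis using assms(3) by blast
qed

lemma half_slope_cong:
  assumes "half_slope K f g" "eventually (\<lambda>z. f (fst z) (snd z) = f' (fst z) (snd z)) (unif_nhds_0 K)"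
  shows "half_slope K f' g"
proof -
  have "taylor2 K f' a b c" if "taylor2 K f a b c" for a b c
    using taylor2_cong[OF that assms(2)] by simp
  then show ?thesis using assms(1) unfolding half_slope_def by blast
qed

section \<open>Fields along coordinate lines\<close>

text \<open>
  Taylor's theorem along the line; the remainder is bounded uniformly because the third
  directional derivative is bounded on a compact neighbourhood of \<open>K\<close> inside \<open>D\<close>.
\<close>

lemma smooth2_C3:
  fixes U :: "'p::euclidean_space \<Rightarrow> real ^ 'n"
  assumes D: "open D" and C3: "C_on 3 U D" and K: "compact K" "K \<subseteq> D" and e: "norm e = 1"
  shows "smooth2 K (\<lambda>p h. U (p + h *\<^sub>R e) $ k)"
proof -
  define d :: "('p \<Rightarrow> real ^ 'n) \<Rightarrow> 'p \<Rightarrow> real ^ 'n" where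
    "d = (\<lambda>W x. frechet_derivative W (at x) e)"
  have diff: "U differentiable (at x)" "d U differentiable (at x)" "d (d U) differentiable (at x)"
    if "x \<in> D" for x
    using C3 that by (auto simp: numeral_3_eq_3 d_def)
  have cont: "continuous_on D (d (d (d U)))"
    using C3 by (auto simp: numeral_3_eq_3 d_def)
  have line: "((\<lambda>h. W (p + h *\<^sub>R e) $ k) has_real_derivative d W (p + t *\<^sub>R e) $ k) (at t)"
    if "W differentiable (at (p + t *\<^sub>R e))" for W :: "'p \<Rightarrow> real ^ 'n" and p t
  proof -
    have "(W has_derivative frechet_derivative W (at (p + t *\<^sub>R e))) (at (p + t *\<^sub>R e))"
      using that by (simp add: frechet_derivative_works)
    then have "((\<lambda>h. W (p + h *\<^sub>R e)) has_derivative
        (\<lambda>h. frechet_derivative W (at (p + t *\<^sub>R e)) (h *\<^sub>R e))) (at t)"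
      by (rule has_derivative_compose[rotated]) (auto intro!: derivative_eq_intros)
    from bounded_linear.has_derivative[OF bounded_linear_vec_nth this, of k]
    have "((\<lambda>h. W (p + h *\<^sub>R e) $ k) has_derivative
        (\<lambda>h. frechet_derivative W (at (p + t *\<^sub>R e)) (h *\<^sub>R e) $ k)) (at t)" .
    moreover have "frechet_derivative W (at (p + t *\<^sub>R e)) (h *\<^sub>R e) $ k = d W (p + t *\<^sub>R e) $ k * h" for h
      using linear_scale[OF linear_frechet_derivative[OF that], of h e] by (simp add: d_def)
    ultimately show ?thesis
      by (simp add: has_field_derivative_def)
  qed
  obtain r where r: "r > 0" "(\<Union>x\<in>K. cball x r) \<subseteq> D"
    using compact_subset_open_imp_cball_epsilon_subset[OF K(1) D K(2)] .
  define K' where "K' = {x + y |x y. x \<in> K \<and> y \<in> cball 0 r}"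
  have K': "compact K'"
    unfolding K'_def by (rule compact_sums[OF K(1) compact_cball])
  have inK': "p + t *\<^sub>R e \<in> K'" if "p \<in> K" "\<bar>t\<bar> \<le> r" for p t
    unfolding K'_def using that e by (intro CollectI exI[of _ p] exI[of _ "t *\<^sub>R e"]) simp
  have "K' \<subseteq> D"
  proof
    fix z assume "z \<in> K'"
    then obtain x y where "z = x + y" "x \<in> K" "norm y \<le> r" by (auto simp: K'_def)
    then have "z \<in> cball x r" by (simp add: dist_norm)
    then show "z \<in> D" using r \<open>x \<in> K\<close> by blast
  qed
  then have "continuous_on K' (\<lambda>x. d (d (d U)) x $ k)"
    using cont continuous_on_subset by (intro continuous_on_component) blast
  then have "bounded ((\<lambda>x. d (d (d U)) x $ k) ` K')"
    by (intro compact_imp_bounded compact_continuous_image K')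
  then obtain M where M: "\<And>x. x \<in> K' \<Longrightarrow> \<bar>d (d (d U)) x $ k\<bar> \<le> M"
    unfolding bounded_iff by auto
  have co: "continuous_on K (\<lambda>p. W p $ k)" if "\<And>x. x \<in> D \<Longrightarrow> W differentiable (at x)"
    for W :: "'p \<Rightarrow> real ^ 'n"
    using that K(2)
    by (intro continuous_on_component continuous_at_imp_continuous_on)
      (auto intro: differentiable_imp_continuous_within)
  have main: "\<bar>U (p + h *\<^sub>R e) $ k - (U p $ k + d U p $ k * h + d (d U) p $ k / 2 * h\<^sup>2)\<bar>
      \<le> M / 6 * \<bar>h ^ 3\<bar>" if "p \<in> K" "\<bar>h\<bar> < r" for p h
  proof -
    define g where "g m = (\<lambda>t. (d ^^ m) U (p + t *\<^sub>R e) $ k)" for m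
    have "\<forall>m t. m < 3 \<and> \<bar>t\<bar> \<le> \<bar>h\<bar> \<longrightarrow> (g m has_real_derivative g (Suc m) t) (at t)"
    proof (intro allI impI)
      fix m :: nat and t :: real assume mt: "m < 3 \<and> \<bar>t\<bar> \<le> \<bar>h\<bar>"
      have "p + t *\<^sub>R e \<in> D"
        using inK'[of p t] \<open>K' \<subseteq> D\<close> mt that by auto
      moreover have "m = 0 \<or> m = 1 \<or> m = 2" using mt by auto
      ultimately have "(d ^^ m) U differentiable (at (p + t *\<^sub>R e))"
        using diff by (auto simp: numeral_2_eq_2)
      from line[OF this] show "(g m has_real_derivative g (Suc m) t) (at t)"
        by (simp add: g_def)
    qed
    from Maclaurin_bi_le[OF refl this]
    obtain t where t: "\<bar>t\<bar> \<le> \<bar>h\<bar>"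
      "g 0 h = (\<Sum>m<3. g m 0 / fact m * h ^ m) + g 3 t / fact 3 * h ^ 3"
      by blast
    have "(\<Sum>m<3. g m 0 / fact m * h ^ m) = U p $ k + d U p $ k * h + d (d U) p $ k / 2 * h\<^sup>2"
      by (simp add: numeral_3_eq_3 g_def numeral_2_eq_2)
    moreover have "g 3 t = d (d (d U)) (p + t *\<^sub>R e) $ k" "g 0 h = U (p + h *\<^sub>R e) $ k"
      by (simp_all add: g_def numeral_3_eq_3)
    ultimately have "U (p + h *\<^sub>R e) $ k = (U p $ k + d U p $ k * h + d (d U) p $ k / 2 * h\<^sup>2)
        + d (d (d U)) (p + t *\<^sub>R e) $ k / 6 * h ^ 3"
      using t(2) by (simp add: fact_numeral)
    then have "U (p + h *\<^sub>R e) $ k - (U p $ k + d U p $ k * h + d (d U) p $ k / 2 * h\<^sup>2)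
        = d (d (d U)) (p + t *\<^sub>R e) $ k / 6 * h ^ 3"
      by (simp only: add_diff_cancel_left')
    then have "\<bar>U (p + h *\<^sub>R e) $ k - (U p $ k + d U p $ k * h + d (d U) p $ k / 2 * h\<^sup>2)\<bar>
        = \<bar>d (d (d U)) (p + t *\<^sub>R e) $ k\<bar> / 6 * \<bar>h ^ 3\<bar>"
      by (simp only: abs_mult abs_divide abs_numeral)
    also have "\<dots> \<le> M / 6 * \<bar>h ^ 3\<bar>"
      using M[OF inK'[of p t]] that t(1) by (intro mult_right_mono) auto
    finally show ?thesis .
  qed
  have "taylor2 K (\<lambda>p h. U (p + h *\<^sub>R e) $ k) (\<lambda>p. U p $ k) (\<lambda>p. d U p $ k)
      (\<lambda>p. d (d U) p $ k / 2)"
    unfolding taylor2_def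
    by (intro conjI co diff continuous_on_divide continuous_on_const bigoI[of _ "M / 6"])
      (use main r in \<open>auto simp: eventually_unif_nhds_0\<close>)
  then show ?thesis unfolding smooth2_def by blast
qed

lemma has_vector_derivative_componentwise:
  fixes F :: "real \<Rightarrow> real ^ 'n"
  assumes "\<And>k. ((\<lambda>h. F h $ k) has_real_derivative deriv (\<lambda>h. F h $ k) x) (at x)"
  shows "(F has_vector_derivative (\<chi> k. deriv (\<lambda>h. F h $ k) x)) (at x)"
proof -
  have "(F has_derivative (\<lambda>h. h *\<^sub>R (\<chi> k. deriv (\<lambda>h. F h $ k) x))) (at x)"
    unfolding has_derivative_componentwise_within[of F _ x UNIV]
  proof
    fix i :: "real ^ 'n" assume "i \<in> Basis"
    then obtain k where "i = axis k 1" by (auto simp: Basis_vec_def)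
    then show "((\<lambda>h. F h \<bullet> i) has_derivative (\<lambda>h. (h *\<^sub>R (\<chi> k. deriv (\<lambda>h. F h $ k) x)) \<bullet> i)) (at x)"
      using assms[of k] by (simp add: inner_axis has_field_derivative_def mult_commute_abs)
  qed
  then show ?thesis by (simp add: has_vector_derivative_def)
qed

lemma vector_derivative_swap:
  assumes "(F has_vector_derivative F') (at x)"
  shows "vector_derivative (\<lambda>s. swap_xy (F s)) (at x) = swap_xy (vector_derivative F (at x))"
proof -
  have "bounded_linear swap_xy" using linear_swap by (simp add: linear_conv_bounded_linear)
  from bounded_linear.has_vector_derivative[OF this assms] show ?thesis
    by (simp add: vector_derivative_at vector_derivative_at[OF assms])
qed

lemma vector_derivative_shift:
  "vector_derivative (\<lambda>h. F (x + h)) (at 0) = vector_derivative F (at x)"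
  unfolding vector_derivative_def has_vector_derivative_def has_derivative_at by simp

lemma norm_bound_componentwise:
  fixes F :: "'p \<Rightarrow> real \<Rightarrow> real ^ 'n"
  assumes "\<And>k. \<exists>M. \<exists>\<delta>>0. \<forall>p\<in>K. \<forall>h. 0 < h \<and> h < \<delta> \<longrightarrow> \<bar>F p h $ k\<bar> \<le> M * h\<^sup>2"
  shows "\<exists>M. \<exists>\<delta>>0. \<forall>p\<in>K. \<forall>h. 0 < h \<and> h < \<delta> \<longrightarrow> norm (F p h) \<le> M * h\<^sup>2"
proof -
  obtain M \<delta> where M: "\<And>k. \<delta> k > 0"
    "\<And>k p h. p \<in> K \<Longrightarrow> 0 < h \<Longrightarrow> h < \<delta> k \<Longrightarrow> \<bar>F p h $ k\<bar> \<le> M k * h\<^sup>2"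
    using assms by metis
  define d where "d = Min (range \<delta>)"
  have d: "d \<le> \<delta> k" for k by (simp add: d_def)
  have "d > 0" unfolding d_def using M(1) by (subst Min_gr_iff) auto
  moreover have "norm (F p h) \<le> sum M UNIV * h\<^sup>2" if "p \<in> K" "0 < h" "h < d" for p h
  proof -
    have "norm (F p h) \<le> (\<Sum>k\<in>UNIV. \<bar>F p h $ k\<bar>)" by (rule norm_le_l1_cart)
    also have "\<dots> \<le> (\<Sum>k\<in>UNIV. M k * h\<^sup>2)"
      using that d by (intro sum_mono M(2)) (auto intro: less_le_trans)
    finally show ?thesis by (simp add: sum_distrib_right)
  qed
  ultimately show ?thesis by blast
qed

section \<open>The truncation error\<close>

lemma smooth2_quantities:
  fixes u :: "'p::topological_space \<Rightarrow> real \<Rightarrow> state"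
  assumes g: "ge > 1" "gi > 1" and K: "compact K"
    and u: "\<And>k. smooth2 K (\<lambda>p h. u p h $ k)" and nz: "\<forall>p\<in>K. rho (u p 0) \<noteq> 0"
  shows "smooth2 K (\<lambda>p h. rho (u p h))" "smooth2 K (\<lambda>p h. p_i (u p h))"
    "smooth2 K (\<lambda>p h. vel_x (u p h))" "smooth2 K (\<lambda>p h. vel_y (u p h))"
    "smooth2 K (\<lambda>p h. vel_sq (u p h))" "smooth2 K (\<lambda>p h. p_e ge gi (u p h))"
proof -
  note smooth = smooth2_const[OF K] smooth2_add[OF K] smooth2_diff[OF K] smooth2_mult[OF K]
    smooth2_divide[OF K]
  show r: "smooth2 K (\<lambda>p h. rho (u p h))" and pion: "smooth2 K (\<lambda>p h. p_i (u p h))"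
    unfolding rho_def p_i_def by (rule u)+
  have E: "smooth2 K (\<lambda>p h. energy (u p h))"
    unfolding energy_def by (rule u)
  show v: "smooth2 K (\<lambda>p h. vel_x (u p h))" "smooth2 K (\<lambda>p h. vel_y (u p h))"
    unfolding vel_x_def vel_y_def by (intro smooth u; use nz in \<open>simp add: rho_def\<close>)+
  show v2: "smooth2 K (\<lambda>p h. vel_sq (u p h))"
    unfolding vel_sq_def power2_eq_square by (intro smooth v)
  show "smooth2 K (\<lambda>p h. p_e ge gi (u p h))"
    unfolding p_e_def by (intro smooth v2 r pion E) (use g in auto)
qed

lemma avg_comp: "avg q (u a) (u b) = avg (\<lambda>h. q (u h)) a b"
  by (simp add: avg_def)

lemma log_mean_comp: "log_mean q (u a) (u b) = log_mean (\<lambda>h. q (u h)) a b"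
  by (simp add: log_mean_def)

text \<open>
  With equal arguments all means reduce to the quantities themselves, so the closure
  properties relate \<open>num_flux_x (u p h) (u p h)\<close> to \<open>num_flux_x (u p 0) (u p h)\<close>; by consistency the former is the
  exact flux wherever the state is admissible, which holds for small \<open>h\<close>, uniformly in \<open>p\<close>.
\<close>

lemma num_flux_x_half_slope:
  fixes u :: "'p::topological_space \<Rightarrow> real \<Rightarrow> state"
  assumes g: "ge > 1" "gi > 1" and K: "compact K"
    and u: "\<And>k. smooth2 K (\<lambda>p h. u p h $ k)" and adm: "\<And>p. p \<in> K \<Longrightarrow> u p 0 \<in> admissible ge gi"
  shows "half_slope K (\<lambda>p h. flux_x ge gi (u p h) $ k) (\<lambda>p h. num_flux_x ge gi (u p 0) (u p h) $ k)"
proof -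
  note smooth = smooth2_const[OF K] smooth2_add[OF K] smooth2_diff[OF K] smooth2_mult[OF K] smooth2_divide[OF K]
  have pos: "rho (u p 0) > 0" "p_e ge gi (u p 0) > 0" "p_i (u p 0) > 0" if "p \<in> K" for p
    using adm[OF that] by (auto simp: admissible_def)
  have nz: "rho (u p 0) \<noteq> 0" "p_e ge gi (u p 0) \<noteq> 0" "p_i (u p 0) \<noteq> 0" if "p \<in> K" for p
    using pos[OF that] by auto
  have bpos: "beta_e ge gi (u p 0) > 0" "beta_i (u p 0) > 0" if "p \<in> K" for p
    using pos[OF that] by (auto simp: beta_e_def beta_i_def)
  have nz_ball: "\<forall>p\<in>K. rho (u p 0) \<noteq> 0" using nz(1) by blast
  note prim = smooth2_quantities[OF g K u nz_ball]
  note r = prim(1) and pion = prim(2) and v = prim(3,4) and v2 = prim(5) and pe = prim(6)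
  have b: "smooth2 K (\<lambda>p h. beta_e ge gi (u p h))" "smooth2 K (\<lambda>p h. beta_i (u p h))"
    unfolding beta_e_def beta_i_def by (intro smooth r pe pion; use nz in simp)+
  have mr: "half_slope K (\<lambda>p h. rho (u p h)) (\<lambda>p h. log_mean rho (u p 0) (u p h))"
    and mbe: "half_slope K (\<lambda>p h. beta_e ge gi (u p h)) (\<lambda>p h. log_mean (beta_e ge gi) (u p 0) (u p h))"
    and mbi: "half_slope K (\<lambda>p h. beta_i (u p h)) (\<lambda>p h. log_mean beta_i (u p 0) (u p h))"
    unfolding log_mean_comp using r b pos(1) bpos by (auto intro!: half_slope_log_mean[OF K])
  have ar: "half_slope K (\<lambda>p h. rho (u p h)) (\<lambda>p h. avg rho (u p 0) (u p h))"
    and abe: "half_slope K (\<lambda>p h. beta_e ge gi (u p h)) (\<lambda>p h. avg (beta_e ge gi) (u p 0) (u p h))"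
    and avx: "half_slope K (\<lambda>p h. vel_x (u p h)) (\<lambda>p h. avg vel_x (u p 0) (u p h))"
    and avy: "half_slope K (\<lambda>p h. vel_y (u p h)) (\<lambda>p h. avg vel_y (u p 0) (u p h))"
    and av2: "half_slope K (\<lambda>p h. vel_sq (u p h)) (\<lambda>p h. avg vel_sq (u p 0) (u p h))"
    unfolding avg_comp using r b v v2 by (auto intro!: half_slope_avg[OF K])
  note means = mr mbe mbi ar abe avx avy av2
  note arith = half_slope_const[of K] half_slope_add half_slope_mult[OF K] half_slope_diff[OF K]
    half_slope_divide[OF K]
  have same: "log_mean q W W = q W" "avg q W W = q W" for q :: "state \<Rightarrow> real" and W
    by (simp_all add: log_mean_def avg_def)
  have bnz: "beta_e ge gi (u p 0) \<noteq> 0" "beta_i (u p 0) \<noteq> 0" "(ge - 1) * beta_e ge gi (u p 0) \<noteq> 0"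
    if "p \<in> K" for p
    using bpos[OF that] g by auto
  have H: "half_slope K (\<lambda>p h. num_flux_x ge gi (u p h) (u p h) $ k)
      (\<lambda>p h. num_flux_x ge gi (u p 0) (u p h) $ k)"
    using exhaust_5[of k]
  proof (elim disjE)
    show ?thesis if "k = 1"
      unfolding num_flux_x_def Let_def that vector_5 same by (intro arith means)
    show ?thesis if "k = 2"
      unfolding num_flux_x_def Let_def that vector_5 same by (intro arith means bnz)
    show ?thesis if "k = 3"
      unfolding num_flux_x_def Let_def that vector_5 same by (intro arith means)
    show ?thesis if "k = 4"
      unfolding num_flux_x_def Let_def that vector_5 same by (intro arith means bnz) (use g in auto)
    show ?thesis if "k = 5"
      unfolding num_flux_x_def Let_def that vector_5 same by (intro arith means bnz)
  qed
  have "eventually (\<lambda>z. rho (u (fst z) (snd z)) > 0) (unif_nhds_0 K)"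
    "eventually (\<lambda>z. p_e ge gi (u (fst z) (snd z)) > 0) (unif_nhds_0 K)"
    "eventually (\<lambda>z. p_i (u (fst z) (snd z)) > 0) (unif_nhds_0 K)"
    by (rule smooth2_eventually_pos[OF K r] smooth2_eventually_pos[OF K pe]
        smooth2_eventually_pos[OF K pion]; erule pos)+
  then have "eventually (\<lambda>z. u (fst z) (snd z) \<in> admissible ge gi) (unif_nhds_0 K)"
    by eventually_elim (simp add: admissible_def)
  then have "eventually (\<lambda>z. num_flux_x ge gi (u (fst z) (snd z)) (u (fst z) (snd z)) $ k
      = flux_x ge gi (u (fst z) (snd z)) $ k) (unif_nhds_0 K)"
    by eventually_elim (simp add: num_flux_x_consistent[OF g])
  then show ?thesis by (rule half_slope_cong[OF H])
qed

text \<open>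
  The part of the truncation error that belongs to the \<open>x\<close> direction, for the field \<open>u\<close> along a line
  through the grid point with parameter \<open>0\<close>.
\<close>

definition residual_x :: "real \<Rightarrow> real \<Rightarrow> (real \<Rightarrow> state) \<Rightarrow> real \<Rightarrow> state" where
  "residual_x ge gi u h =
     (num_flux_x ge gi (u 0) (u h) - num_flux_x ge gi (u (- h)) (u 0)) /\<^sub>R h
     + C_x ge gi (u 0) *v ((u h - u (- h)) /\<^sub>R (2 * h))
     - (vector_derivative (\<lambda>s. flux_x ge gi (u s)) (at 0)
        + C_x ge gi (u 0) *v vector_derivative u (at 0))"

lemma smooth2_C_x:
  fixes u :: "'p::topological_space \<Rightarrow> real \<Rightarrow> state"
  assumes g: "ge > 1" "gi > 1" and K: "compact K"
    and u: "\<And>k. smooth2 K (\<lambda>p h. u p h $ k)" and adm: "\<And>p. p \<in> K \<Longrightarrow> u p 0 \<in> admissible ge gi"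
  shows "smooth2 K (\<lambda>p h. C_x ge gi (u p h) $ k $ j)"
proof -
  note smooth = smooth2_const[OF K] smooth2_add[OF K] smooth2_diff[OF K] smooth2_mult[OF K] smooth2_divide[OF K]
  have nz: "rho (u p 0) \<noteq> 0" if "p \<in> K" for p
    using adm[OF that] by (auto simp: admissible_def)
  have nz_ball: "\<forall>p\<in>K. rho (u p 0) \<noteq> 0" using nz by blast
  note prim = smooth2_quantities[OF g K u nz_ball]
  note r = prim(1) and pion = prim(2) and v = prim(3,4) and v2 = prim(5) and pe = prim(6)
  have minus: "smooth2 K (\<lambda>p h. - f p h)" if "smooth2 K f" for f
    using smooth2_diff[OF K smooth2_const[OF K, of 0] that] by simp
  show ?thesis
    using exhaust_5[of k] exhaust_5[of j] unfolding C_x_def Let_def power2_eq_square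
    by (elim disjE; hypsubst; unfold vector_5; intro smooth minus v v2 pe r pion; use nz g in auto)
qed

text \<open>
  The nonconservative term has the form of a flux difference, too: let \<open>w\<close> be the product of the matrix at
  \<open>h = 0\<close> with the field.  Then \<open>(w h - w (- h)) / (2 h) = (g h - g (- h)) / h\<close> for the two-point
  function \<open>g h = avg w 0 h\<close>, which has half the slope of \<open>w\<close>.
\<close>

lemma residual_x_bound:
  fixes u :: "'p::topological_space \<Rightarrow> real \<Rightarrow> state"
  assumes g: "ge > 1" "gi > 1" and K: "compact K"
    and u: "\<And>k. smooth2 K (\<lambda>p h. u p h $ k)" and adm: "\<And>p. p \<in> K \<Longrightarrow> u p 0 \<in> admissible ge gi"
  shows "\<exists>M. \<exists>\<delta>>0. \<forall>p\<in>K. \<forall>h. 0 < h \<and> h < \<delta> \<longrightarrow> norm (residual_x ge gi (u p) h) \<le> M * h\<^sup>2"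
proof (rule norm_bound_componentwise)
  fix k :: 5
  define C where "C p j = C_x ge gi (u p 0) $ k $ j" for p j
  define w where "w p h = (\<Sum>j\<in>UNIV. C p j * u p h $ j)" for p h
  define f where "f p h = flux_x ge gi (u p h) $ k" for p h
  have C: "smooth2 K (\<lambda>p h. C p j)" for j
    unfolding C_def by (rule smooth2_at_0[OF smooth2_C_x[OF g K u adm]])
  have w: "smooth2 K w"
    unfolding w_def[abs_def] sum_5 by (intro smooth2_add[OF K] smooth2_mult[OF K] C u)
  note flux = num_flux_x_half_slope[OF g K u adm]
  have f: "smooth2 K f"
    using smooth2_left[OF flux] by (simp add: f_def[abs_def])
  define G where "G p h = num_flux_x ge gi (u p 0) (u p h) $ k + avg (w p) 0 h" for p h
  have "half_slope K (\<lambda>p h. f p h + w p h) G"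
    unfolding f_def G_def[abs_def] by (intro half_slope_add flux half_slope_avg[OF K] w)
  from half_slope_central_difference[OF K this] obtain M \<delta> where M: "\<delta> > 0"
    "\<And>p h. p \<in> K \<Longrightarrow> 0 < h \<Longrightarrow> h < \<delta> \<Longrightarrow>
      \<bar>(G p h - G p (- h)) / h - deriv (\<lambda>h. f p h + w p h) 0\<bar> \<le> M * h\<^sup>2"
    by blast
  have "residual_x ge gi (u p) h $ k = (G p h - G p (- h)) / h - deriv (\<lambda>h. f p h + w p h) 0"
    if "p \<in> K" for p h
  proof -
    have 1: "vector_derivative (\<lambda>s. flux_x ge gi (u p s)) (at 0) $ k = deriv (f p) 0"
      unfolding f_def[abs_def]
      by (subst vector_derivative_at[OF has_vector_derivative_componentwise])
        (auto intro: smooth2_differentiable[OF K smooth2_left[OF num_flux_x_half_slope[OF g K u adm]] that])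
    have 2: "vector_derivative (u p) (at 0) $ j = deriv (\<lambda>h. u p h $ j) 0" for j
      by (subst vector_derivative_at[OF has_vector_derivative_componentwise])
        (auto intro: smooth2_differentiable[OF K u that])
    have "(w p has_real_derivative (\<Sum>j\<in>UNIV. C p j * deriv (\<lambda>h. u p h $ j) 0)) (at 0)"
      unfolding w_def[abs_def] by (intro DERIV_sum DERIV_cmult smooth2_differentiable[OF K u that])
    from DERIV_add[OF smooth2_differentiable[OF K f that] this]
    have 3: "deriv (\<lambda>h. f p h + w p h) 0 = deriv (f p) 0 + (\<Sum>j\<in>UNIV. C p j * deriv (\<lambda>h. u p h $ j) 0)"
      by (rule DERIV_imp_deriv)
    have 4: "(C_x ge gi (u p 0) *v x) $ k = (\<Sum>j\<in>UNIV. C p j * x $ j)" for x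
      by (simp add: matrix_vector_mult_def C_def)
    have 5: "w p s = (C_x ge gi (u p 0) *v u p s) $ k" for s
      by (simp add: 4 w_def)
    have 6: "(C_x ge gi (u p 0) *v ((u p h - u p (- h)) /\<^sub>R (2 * h))) $ k = (w p h - w p (- h)) / (2 * h)"
      unfolding 5 by (simp add: matrix_vector_mult_scaleR matrix_vector_mult_diff_distrib inverse_eq_divide)
    have "(G p h - G p (- h)) / h = (num_flux_x ge gi (u p 0) (u p h) $ k
        - num_flux_x ge gi (u p (- h)) (u p 0) $ k) / h + (w p h - w p (- h)) / (2 * h)"
      by (simp add: G_def avg_def num_flux_x_sym[of ge gi "u p (- h)"] add_divide_distrib
          diff_divide_distrib)
    then show ?thesis
      unfolding residual_x_def 3 vector_minus_component vector_add_component 6 1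
      by (simp add: 4 2 inverse_eq_divide)
  qed
  then show "\<exists>M. \<exists>\<delta>>0. \<forall>p\<in>K. \<forall>h. 0 < h \<and> h < \<delta> \<longrightarrow> \<bar>residual_x ge gi (u p) h $ k\<bar> \<le> M * h\<^sup>2"
    using M by (intro exI[of _ M] exI[of _ \<delta>]) auto
qed

definition residual_y :: "real \<Rightarrow> real \<Rightarrow> (real \<Rightarrow> state) \<Rightarrow> real \<Rightarrow> state" where
  "residual_y ge gi u h =
     (num_flux_y ge gi (u 0) (u h) - num_flux_y ge gi (u (- h)) (u 0)) /\<^sub>R h
     + C_y ge gi (u 0) *v ((u h - u (- h)) /\<^sub>R (2 * h))
     - (vector_derivative (\<lambda>s. flux_y ge gi (u s)) (at 0)
        + C_y ge gi (u 0) *v vector_derivative u (at 0))"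

text \<open>
  Exchanging the momentum components turns the residual in the \<open>y\<close> direction into the one in the \<open>x\<close>
  direction for the exchanged states along the same line.
\<close>

lemma residual_y_bound:
  fixes u :: "'p::topological_space \<Rightarrow> real \<Rightarrow> state"
  assumes g: "ge > 1" "gi > 1" and K: "compact K"
    and u: "\<And>k. smooth2 K (\<lambda>p h. u p h $ k)" and adm: "\<And>p. p \<in> K \<Longrightarrow> u p 0 \<in> admissible ge gi"
  shows "\<exists>M. \<exists>\<delta>>0. \<forall>p\<in>K. \<forall>h. 0 < h \<and> h < \<delta> \<longrightarrow> norm (residual_y ge gi (u p) h) \<le> M * h\<^sup>2"
proof -
  define w where "w p h = swap_xy (u p h)" for p h
  have w: "smooth2 K (\<lambda>p h. w p h $ k)" for k
    using exhaust_5[of k] by (elim disjE) (simp_all add: w_def u)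
  have adm': "w p 0 \<in> admissible ge gi" if "p \<in> K" for p
    using adm[OF that] by (simp add: w_def)
  have "residual_y ge gi (u p) h = swap_xy (residual_x ge gi (w p) h)" if "p \<in> K" for p h
  proof -
    have "vector_derivative (w p) (at 0) = swap_xy (vector_derivative (u p) (at 0))"
      unfolding w_def[abs_def]
      by (rule vector_derivative_swap[OF has_vector_derivative_componentwise])
        (rule smooth2_differentiable[OF K u that])
    moreover have "vector_derivative (\<lambda>s. flux_y ge gi (u p s)) (at 0)
        = swap_xy (vector_derivative (\<lambda>s. flux_x ge gi (w p s)) (at 0))"
      unfolding flux_y_swap w_def[symmetric]
      by (rule vector_derivative_swap[OF has_vector_derivative_componentwise])
        (rule smooth2_differentiable[OF K smooth2_left[OF num_flux_x_half_slope[OF g K w adm']] that])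
    ultimately show ?thesis
      unfolding residual_y_def residual_x_def
      by (simp add: num_flux_y_swap C_y_swap w_def linear_add[OF linear_swap]
          linear_diff[OF linear_swap] linear_scale[OF linear_swap])
  qed
  then show ?thesis
    using residual_x_bound[OF g K w adm'] by (simp add: norm_swap)
qed

text \<open>
  The time derivatives cancel, since the scheme is not discretised in time.
\<close>

lemma truncation_error_split:
  fixes U :: field
  assumes p: "p = (t, x0 + of_int i * dx, y0 + of_int j * dy)"
  shows "scheme_residual ge gi dx dy (sample x0 y0 dx dy U) i j t - pde_residual ge gi U p
    = residual_x ge gi (\<lambda>h. U (p + h *\<^sub>R (0, 1, 0))) dx + residual_y ge gi (\<lambda>h. U (p + h *\<^sub>R (0, 0, 1))) dy"
proof -
  define X Y where "X = x0 + of_int i * dx" and "Y = y0 + of_int j * dy"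
  have nb: "sample x0 y0 dx dy U i j t = U (t, X, Y)"
    "sample x0 y0 dx dy U (i + 1) j t = U (t, X + dx, Y)"
    "sample x0 y0 dx dy U (i - 1) j t = U (t, X - dx, Y)"
    "sample x0 y0 dx dy U i (j + 1) t = U (t, X, Y + dy)"
    "sample x0 y0 dx dy U i (j - 1) t = U (t, X, Y - dy)"
    by (simp_all add: sample_def X_def Y_def algebra_simps)
  have s: "sample x0 y0 dx dy U i j = (\<lambda>s. U (s, X, Y))"
    by (simp add: fun_eq_iff sample_def X_def Y_def)
  have p': "p = (t, X, Y)" by (simp add: p X_def Y_def)
  show ?thesis
    unfolding scheme_residual_def scheme_rhs_def pde_residual_def residual_x_def residual_y_def
      central_x_def central_y_def s nb p'
    by (simp add: vector_derivative_shift[of "\<lambda>s. U (t, s, Y)"]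
        vector_derivative_shift[of "\<lambda>s. flux_x ge gi (U (t, s, Y))"]
        vector_derivative_shift[of "\<lambda>s. U (t, X, s)"]
        vector_derivative_shift[of "\<lambda>s. flux_y ge gi (U (t, X, s))"] fun_eq_iff)
qed

theorem second_order_accuracy:
  assumes g: "ge > 1" "gi > 1"
  shows "second_order_accurate ge gi"
  unfolding second_order_accurate_def
proof (intro allI impI)
  fix D and U :: field and K
  assume "open D \<and> C_on 3 U D \<and> U ` D \<subseteq> admissible ge gi \<and> compact K \<and> K \<subseteq> D"
  then have D: "open D" "C_on 3 U D" "U ` D \<subseteq> admissible ge gi" and K: "compact K" "K \<subseteq> D"
    by auto
  define ux where "ux p h = U (p + h *\<^sub>R (0, 1, 0))" for p h
  define uy where "uy p h = U (p + h *\<^sub>R (0, 0, 1))" for p h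
  have u: "smooth2 K (\<lambda>p h. ux p h $ k)" "smooth2 K (\<lambda>p h. uy p h $ k)" for k
    unfolding ux_def uy_def by (rule smooth2_C3[OF D(1,2) K]; simp add: norm_Pair)+
  have adm: "ux p 0 \<in> admissible ge gi" "uy p 0 \<in> admissible ge gi" if "p \<in> K" for p
    using that D(3) K(2) by (auto simp: ux_def uy_def simp flip: zero_prod_def)
  obtain Mx dx where x: "dx > 0" "\<And>p h. p \<in> K \<Longrightarrow> 0 < h \<Longrightarrow> h < dx \<Longrightarrow>
      norm (residual_x ge gi (ux p) h) \<le> Mx * h\<^sup>2"
    using residual_x_bound[OF g K(1) u(1) adm(1)] by auto
  obtain My dy where y: "dy > 0" "\<And>p h. p \<in> K \<Longrightarrow> 0 < h \<Longrightarrow> h < dy \<Longrightarrow>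
      norm (residual_y ge gi (uy p) h) \<le> My * h\<^sup>2"
    using residual_y_bound[OF g K(1) u(2) adm(2)] by auto
  show "\<exists>B. \<exists>\<delta>>0. \<forall>dx dy x0 y0 t i j.
          0 < dx \<and> dx < \<delta> \<and> 0 < dy \<and> dy < \<delta> \<and>
          (t, x0 + of_int i * dx, y0 + of_int j * dy) \<in> K \<longrightarrow>
          norm (scheme_residual ge gi dx dy (sample x0 y0 dx dy U) i j t
                - pde_residual ge gi U (t, x0 + of_int i * dx, y0 + of_int j * dy))
            \<le> B * (dx\<^sup>2 + dy\<^sup>2)"
  proof (rule exI[of _ "max Mx My"], rule exI[of _ "min dx dy"], intro conjI allI impI)
    show "min dx dy > 0" using x(1) y(1) by simp
    fix hx hy x0 y0 t :: real and i j :: int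
    let ?p = "(t, x0 + of_int i * hx, y0 + of_int j * hy)"
    assume h: "0 < hx \<and> hx < min dx dy \<and> 0 < hy \<and> hy < min dx dy \<and> ?p \<in> K"
    have "norm (residual_x ge gi (ux ?p) hx + residual_y ge gi (uy ?p) hy)
        \<le> Mx * hx\<^sup>2 + My * hy\<^sup>2"
      by (rule norm_triangle_mono[OF x(2) y(2)]) (use h in auto)
    also have "\<dots> \<le> max Mx My * hx\<^sup>2 + max Mx My * hy\<^sup>2"
      by (intro add_mono mult_right_mono) auto
    finally show "norm (scheme_residual ge gi hx hy (sample x0 y0 hx hy U) i j t - pde_residual ge gi U ?p)
        \<le> max Mx My * (hx\<^sup>2 + hy\<^sup>2)"
      unfolding truncation_error_split[OF refl] ux_def uy_def by (simp add: distrib_left)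
  qed
qed

section \<open>Accuracy and entropy conservation of the scheme\<close>

theorem mainTheorem4:
  fixes ge gi :: real
  assumes "ge > 1" and "gi > 1"
  shows "second_order_accurate ge gi
    \<and> (\<forall>dx dy G T u i j t.
         dx > 0 \<and> dy > 0 \<and> scheme_solution ge gi dx dy G T u \<and> stencil i j \<subseteq> G \<and> t \<in> T \<longrightarrow>
         ((\<lambda>s. entropy ge gi (u i j s)) has_real_derivative
            - (num_entropy_flux_x ge gi (u i j t) (u (i + 1) j t)
               - num_entropy_flux_x ge gi (u (i - 1) j t) (u i j t)) / dx
            - (num_entropy_flux_y ge gi (u i j t) (u i (j + 1) t)
               - num_entropy_flux_y ge gi (u i (j - 1) t) (u i j t)) / dy) (at t within T))
    \<and> consistent_on (admissible ge gi) (num_entropy_flux_x ge gi) (entropy_flux_x ge gi)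
    \<and> consistent_on (admissible ge gi) (num_entropy_flux_y ge gi) (entropy_flux_y ge gi)"
proof (intro conjI allI impI)
  show "second_order_accurate ge gi" by (rule second_order_accuracy[OF assms])
  show "consistent_on (admissible ge gi) (num_entropy_flux_x ge gi) (entropy_flux_x ge gi)"
    "consistent_on (admissible ge gi) (num_entropy_flux_y ge gi) (entropy_flux_y ge gi)"
    by (simp_all add: consistent_on_def num_entropy_flux_x_consistent[OF assms]
        num_entropy_flux_y_consistent[OF assms])
next
  fix dx dy G T u i j t
  assume asm: "dx > 0 \<and> dy > 0 \<and> scheme_solution ge gi dx dy G T u \<and> stencil i j \<subseteq> G \<and> t \<in> T"
  have adm: "u k l t \<in> admissible ge gi" if "(k, l) \<in> stencil i j" for k l
  proof -
    have "(k, l) \<in> G" using asm that by blast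
    then show ?thesis using asm by (auto simp: scheme_solution_def)
  qed
  have "(u i j has_derivative (\<lambda>h. h *\<^sub>R scheme_rhs ge gi dx dy (\<lambda>k l. u k l t) i j)) (at t within T)"
    using asm by (auto simp: scheme_solution_def has_vector_derivative_def)
  moreover have "(entropy ge gi has_derivative (\<lambda>h. h \<bullet> entropy_var ge gi (u i j t))) (at (u i j t))"
    using GDERIV_entropy[OF assms adm[of i j]] by (simp add: gderiv_def stencil_def)
  ultimately have "((\<lambda>s. entropy ge gi (u i j s)) has_derivative
      (\<lambda>h. (h *\<^sub>R scheme_rhs ge gi dx dy (\<lambda>k l. u k l t) i j) \<bullet> entropy_var ge gi (u i j t)))
      (at t within T)"
    by (rule has_derivative_compose)
  then have "((\<lambda>s. entropy ge gi (u i j s)) has_real_derivative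
      scheme_rhs ge gi dx dy (\<lambda>k l. u k l t) i j \<bullet> entropy_var ge gi (u i j t)) (at t within T)"
    by (simp add: has_field_derivative_def mult_commute_abs)
  then show "((\<lambda>s. entropy ge gi (u i j s)) has_real_derivative
            - (num_entropy_flux_x ge gi (u i j t) (u (i + 1) j t)
               - num_entropy_flux_x ge gi (u (i - 1) j t) (u i j t)) / dx
            - (num_entropy_flux_y ge gi (u i j t) (u i (j + 1) t)
               - num_entropy_flux_y ge gi (u i (j - 1) t) (u i j t)) / dy) (at t within T)"
    using scheme_entropy_balance[of ge gi i j "\<lambda>k l. u k l t" dx dy] assms adm by simp
qed

end
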